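(* Let $n\ge1$ and let $U^{\mathrm{ext}}_q(\widehat{\mathfrak{sp}}_{2n})$ be the extended quantum affine algebra defined in the context. Put $\xi=q^{-2n-2}$ and $$z^{\pm}(u)=\prod_{i=1}^{n-1}h^{\pm}_{i}(u\xi q^{2i})^{-1}\prod_{i=1}^{n}h^{\pm}_{i}(u\xi q^{2i-2})\,h^{\pm}_{n+1}(u).$$ Then the coefficients of $z^{+}(u)$ and $z^-(u)$ are central elements of $U^{\mathrm{ext}}_q(\widehat{\mathfrak{sp}}_{2n})$.
   Context: **Notation.** $q$ is a variable; algebras are over $\mathbb C(q)$. $\epsilon_1,\dots,\epsilon_n$ is an orthonormal basis of a Euclidean space; $\alpha_i=\epsilon_i-\epsilon_{i+1}$ ($i<n$), $\alpha_n=2\epsilon_n$; $A_{ij}=2(\alpha_i,\alpha_j)/(\alpha_i,\alpha_i)$; $q_i=q^{(\alpha_i,\alpha_i)/2}$; $[k]_q=(q^k-q^{-k})/(q-q^{-1})$; $\binom{k}{r}_q=[k]_q!/([r]_q![k-r]_q!)$; $\xi=q^{-2n-2}$; $u_\pm=uq^{\pm c/2}$; $\delta(u)=\sum_{r\in\mathbb Z}u^r$. Let $f(u)=1+\sum_{k\ge1}f_ku^k$, $f_k\in\mathbb C(q)$, be the unique series with $f(u)f(u\xi)=\big((1-uq^{-2})(1-uq^2)(1-u\xi)(1-u\xi^{-1})\big)^{-1}$, and $g(u)=f(u)(u-q^{-2})(u-\xi)$. **Extended algebra.** $U^{\mathrm{ext}}_q(\widehat{\mathfrak{sp}}_{2n})$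 has generators $X^\pm_{i,k}$ ($1\le i\le n$, $k\in\mathbb Z$), $h^+_{j,m},h^-_{j,-m}$ ($1\le j\le n+1$, $m\ge0$), $q^{c/2}$. Put $X_i^\pm(u)=\sum_kX^\pm_{i,k}u^{-k}$, $h^\pm_i(u)=\sum_{m\ge0}h^\pm_{i,\pm m}u^{\pm m}$. Relations: $q^{c/2}$ central invertible; $h^+_{i,0}h^-_{i,0}=h^-_{i,0}h^+_{i,0}=1$; $h^+_{n,0}h^+_{n+1,0}=1$; $h^\pm_i(u)h^\pm_j(v)=h^\pm_j(v)h^\pm_i(u)$; $$g\big((uq^c/v)^{\pm1}\big)h_i^\pm(u)h_i^\mp(v)=g\big((uq^{-c}/v)^{\pm1}\big)h_i^\mp(v)h_i^\pm(u);$$ $$g\big((uq^c/v)^{\pm1}\big)\tfrac{u_\pm-v_\mp}{qu_\pm-q^{-1}v_\mp}h_i^\pm(u)h_j^\mp(v)=g\big((uq^{-c}/v)^{\pm1}\big)\tfrac{u_\mp-v_\pm}{qu_\mp-q^{-1}v_\pm}h_j^\mp(v)h_i^\pm(u)\quad(i<j,\ i\ne n);$$ $$g\big((uq^c/v)^{\pm1}\big)\tfrac{u_\pm-v_\mp}{q^2u_\pm-q^{-2}v_\mp}h_n^\pm(u)h_{n+1}^\mp(v)=g\big((uq^{-c}/v)^{\pm1}\big)\tfrac{u_\mp-v_\pm}{q^2u_\mp-q^{-2}v_\pm}h_{n+1}^\mp(v)h_n^\pm(u);$$ for $i\ne n+1$: $h_i^\pm(u)X_j^+(v)=\tfrac{u-v_\pm}{q^{(\epsilon_i,\alpha_j)}u-q^{-(\epsilon_i,\alpha_j)}v_\pm}X_j^+(v)h_i^\pm(u)$,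 $h_i^\pm(u)X_j^-(v)=\tfrac{q^{(\epsilon_i,\alpha_j)}u_\pm-q^{-(\epsilon_i,\alpha_j)}v}{u_\pm-v}X_j^-(v)h_i^\pm(u)$; $h_{n+1}^\pm(u)X_n^+(v)=\tfrac{u_\mp-v}{q^{-2}u_\mp-q^2v}X_n^+(v)h_{n+1}^\pm(u)$, $h_{n+1}^\pm(u)X_n^-(v)=\tfrac{q^{-2}u_\pm-q^2v}{u_\pm-v}X_n^-(v)h_{n+1}^\pm(u)$; $h_{n+1}^\pm(u)^{-1}X_{n-1}^+(v)h_{n+1}^\pm(u)=\tfrac{q^{-1}u-qv_\pm}{q^{-2}u-q^2v_\pm}X_{n-1}^+(v)$, $h_{n+1}^\pm(u)X_{n-1}^-(v)h_{n+1}^\pm(u)^{-1}=\tfrac{q^{-1}u-qv_\mp}{q^{-2}u-q^2v_\mp}X_{n-1}^-(v)$; $h^\pm_{n+1}(u)$ commutes with $X_i^+(v)$, $X_i^-(v)$ for $1\le i\le n-2$; $(u-q^{\pm(\alpha_i,\alpha_j)}v)X_i^\pm(uq^i)X_j^\pm(vq^j)=(q^{\pm(\alpha_i,\alpha_j)}u-v)X_j^\pm(vq^j)X_i^\pm(uq^i)$ for $i,j<n$; $(u-q^{\pm(\alpha_i,\alpha_n)}v)X_i^\pm(uq^i)X_n^\pm(vq^{n+1})=(q^{\pm(\alpha_i,\alpha_n)}u-v)X_n^\pm(vq^{n+1})X_i^\pm(uq^i)$ for $i<n$; $(u-q^{\pm(\alpha_n,\alpha_n)}v)X_n^\pm(u)X_n^\pm(v)=(q^{\pm(\alpha_n,\alpha_n)}u-v)X_n^\pm(v)X_n^\pm(u)$;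 $$[X_i^+(u),X_j^-(v)]=\delta_{ij}(q_i-q_i^{-1})\big(\delta(uq^{-c}/v)h_i^-(v_+)^{-1}h_{i+1}^-(v_+)-\delta(uq^c/v)h_i^+(u_+)^{-1}h_{i+1}^+(u_+)\big);$$ $$\sum_{\pi\in\mathfrak S_r}\sum_{l=0}^r(-1)^l\binom{r}{l}_{q_i}X_i^\pm(u_{\pi(1)})\cdots X_i^\pm(u_{\pi(l)})X_j^\pm(v)X_i^\pm(u_{\pi(l+1)})\cdots X_i^\pm(u_{\pi(r)})=0,\quad i\ne j,\ r=1-A_{ij}.$$ Rational functions are expanded in nonnegative powers of $u/v$ in relations where $h^+(u)$ occurs together with $h^-(v)$ or $X(v)$, and in nonnegative powers of $v/u$ where $h^-(u)$ occurs with $h^+(v)$ or $X(v)$. *)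

theory Defs
  imports
    "HOL-Computational_Algebra.Polynomial"
    "HOL-Computational_Algebra.Formal_Power_Series"
    "HOL-Computational_Algebra.Fraction_Field"
    "HOL-Combinatorics.Permutations"
    "HOL-Library.Poly_Mapping"
    "HOL-Library.Cardinality"
begin

section \<open>The ground field and scalar data\<close>

type_synonym cq = "complex poly fract"

definition q :: cq where "q = Fract [:0, 1:] 1"

text \<open>Vectors of the Euclidean space are given by their coordinates with respect to the
  orthonormal basis \<open>\<epsilon>\<^sub>1, \<dots>, \<epsilon>\<^sub>n\<close>; only integer coordinates occur.\<close>

definition eps :: "nat \<Rightarrow> nat \<Rightarrow> int" where
  "eps i = (\<lambda>k. if k = i then 1 else 0)"

definition alpha :: "nat \<Rightarrow> nat \<Rightarrow> nat \<Rightarrow> int" where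
  "alpha n i = (if i < n then (\<lambda>k. eps i k - eps (i + 1) k) else (\<lambda>k. 2 * eps n k))"

definition ip :: "nat \<Rightarrow> (nat \<Rightarrow> int) \<Rightarrow> (nat \<Rightarrow> int) \<Rightarrow> int" where
  "ip n x y = (\<Sum>k = 1..n. x k * y k)"

text \<open>Both divisions below are exact, as \<open>(\<alpha>\<^sub>i, \<alpha>\<^sub>i) \<in> {2, 4}\<close> and the Cartan matrix is integral.\<close>

definition cartan :: "nat \<Rightarrow> nat \<Rightarrow> nat \<Rightarrow> int" where
  "cartan n i j = 2 * ip n (alpha n i) (alpha n j) div ip n (alpha n i) (alpha n i)"

definition qi :: "nat \<Rightarrow> nat \<Rightarrow> cq" where
  "qi n i = q powi (ip n (alpha n i) (alpha n i) div 2)"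

definition qint :: "cq \<Rightarrow> nat \<Rightarrow> cq" where
  "qint t k = (t powi int k - t powi (- int k)) / (t - inverse t)"

definition qfact :: "cq \<Rightarrow> nat \<Rightarrow> cq" where
  "qfact t k = (\<Prod>m = 1..k. qint t m)"

definition qbinom :: "cq \<Rightarrow> nat \<Rightarrow> nat \<Rightarrow> cq" where
  "qbinom t k r = qfact t k / (qfact t r * qfact t (k - r))"

definition xi :: "nat \<Rightarrow> cq" where
  "xi n = q powi (- 2 * int n - 2)"

definition is_f_series :: "nat \<Rightarrow> cq fps \<Rightarrow> bool" where
  "is_f_series n f \<longleftrightarrow> fps_nth f 0 = 1 \<and>
     f * (f oo (fps_const (xi n) * fps_X)) =
       inverse ((1 - fps_const (q powi -2) * fps_X) * (1 - fps_const (q powi 2) * fps_X) *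
                (1 - fps_const (xi n) * fps_X) * (1 - fps_const (inverse (xi n)) * fps_X))"

definition f_series :: "nat \<Rightarrow> cq fps" where
  "f_series n = (THE f. is_f_series n f)"

definition g_series :: "nat \<Rightarrow> cq fps" where
  "g_series n = f_series n * (fps_X - fps_const (q powi -2)) * (fps_X - fps_const (xi n))"


subsection \<open>Existence and uniqueness of the series \<open>f\<close>\<close>

lemma q_power_plus_one_nonzero:
  assumes "m > 0" shows "q ^ m + 1 \<noteq> 0"
proof -
  have pow: "q ^ m = Fract (monom 1 m) 1"
    by (induction m) (auto simp: q_def One_fract_def monom_Suc monom_0 one_pCons)
  have "coeff (monom (1 :: complex) m + 1) 0 = 1"
    using assms by simp
  hence "monom (1 :: complex) m + 1 \<noteq> 0"
    by (metis coeff_0 zero_neq_one)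
  thus ?thesis
    unfolding pow by (simp add: One_fract_def Zero_fract_def eq_fract)
qed

lemma q_nonzero [simp]: "q \<noteq> 0"
  by (simp add: q_def Zero_fract_def eq_fract)

lemma xi_nonzero [simp]: "xi n \<noteq> 0"
  by (simp add: xi_def)

lemma one_plus_xi_power_nonzero:
  assumes "k > 0" shows "1 + xi n ^ k \<noteq> 0"
proof
  assume eq: "1 + xi n ^ k = 0"
  have "xi n = inverse (q ^ (2 * n + 2))"
    by (simp add: xi_def power_int_def nat_add_distrib nat_mult_distrib power_inverse)
  hence "xi n ^ k = inverse (q ^ ((2 * n + 2) * k))"
    by (metis power_inverse power_mult)
  hence "q ^ ((2 * n + 2) * k) + 1 = q ^ ((2 * n + 2) * k) * (1 + xi n ^ k)"
    by (simp add: field_simps)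
  thus False
    using eq q_power_plus_one_nonzero[of "(2 * n + 2) * k"] assms by simp
qed

fun half_series :: "'k::field fps \<Rightarrow> 'k \<Rightarrow> nat \<Rightarrow> 'k" where
  "half_series F t k = (if k = 0 then 1 else
     (fps_nth F k - (\<Sum>i = 1..<k. half_series F t i * (half_series F t (k - i) * t ^ (k - i))))
       / (1 + t ^ k))"

declare half_series.simps [simp del]

lemma half_series_nth_iff:
  fixes f :: "'k::field fps"
  assumes "fps_nth f 0 = 1" "k > 0"
  shows "fps_nth (f * (f oo (fps_const t * fps_X))) k =
         (1 + t ^ k) * fps_nth f k +
         (\<Sum>i = 1..<k. fps_nth f i * (fps_nth f (k - i) * t ^ (k - i)))"
proof -
  have set: "{0..k} = insert 0 (insert k {1..<k})" using assms(2) by auto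
  show ?thesis
    unfolding fps_mult_nth fps_compose_linear set
    using assms by (simp add: algebra_simps)
qed

lemma half_series_ex1:
  fixes F :: "'k::field fps"
  assumes "fps_nth F 0 = 1" "\<And>k. k > 0 \<Longrightarrow> 1 + t ^ k \<noteq> 0"
  shows "\<exists>!f. fps_nth f 0 = 1 \<and> f * (f oo (fps_const t * fps_X)) = F"
proof -
  have char: "f * (f oo (fps_const t * fps_X)) = F \<longleftrightarrow> (\<forall>k. fps_nth f k = half_series F t k)"
    if f0: "fps_nth f 0 = 1" for f
  proof
    assume eq: "f * (f oo (fps_const t * fps_X)) = F"
    show "\<forall>k. fps_nth f k = half_series F t k"
    proof
      fix k show "fps_nth f k = half_series F t k"
      proof (induction k rule: less_induct)
        case (less k)
        show ?case
        proof (cases "k = 0")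
          case False
          with half_series_nth_iff[OF f0, of k t] eq
          have "fps_nth F k = (1 + t ^ k) * fps_nth f k +
             (\<Sum>i = 1..<k. fps_nth f i * (fps_nth f (k - i) * t ^ (k - i)))" by simp
          also have "(\<Sum>i = 1..<k. fps_nth f i * (fps_nth f (k - i) * t ^ (k - i))) =
             (\<Sum>i = 1..<k. half_series F t i * (half_series F t (k - i) * t ^ (k - i)))"
            by (intro sum.cong refl) (use less in auto)
          finally show ?thesis
            using False assms(2)[of k] by (subst half_series.simps) (simp add: field_simps)
        qed (simp add: f0 half_series.simps)
      qed
    qed
  next
    assume eq: "\<forall>k. fps_nth f k = half_series F t k"
    show "f * (f oo (fps_const t * fps_X)) = F"
    proof (rule fps_ext)
      fix k show "fps_nth (f * (f oo (fps_const t * fps_X))) k = fps_nth F k"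
      proof (cases "k = 0")
        case False
        hence "fps_nth (f * (f oo (fps_const t * fps_X))) k = (1 + t ^ k) * half_series F t k +
           (\<Sum>i = 1..<k. half_series F t i * (half_series F t (k - i) * t ^ (k - i)))"
          using half_series_nth_iff[OF f0, of k t] eq by simp
        also have "\<dots> = fps_nth F k"
          using False assms(2)[of k] by (subst half_series.simps) (simp add: field_simps)
        finally show ?thesis .
      qed (simp add: f0 assms(1) fps_compose_linear)
    qed
  qed
  show ?thesis
  proof (rule ex1I[of _ "Abs_fps (half_series F t)"])
    have "fps_nth (Abs_fps (half_series F t)) 0 = 1" by (simp add: half_series.simps)
    thus "fps_nth (Abs_fps (half_series F t)) 0 = 1 \<and>
       Abs_fps (half_series F t) * (Abs_fps (half_series F t) oo (fps_const t * fps_X)) = F"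
      by (simp add: char)
  next
    fix f assume "fps_nth f 0 = 1 \<and> f * (f oo (fps_const t * fps_X)) = F"
    thus "f = Abs_fps (half_series F t)"
      using char[of f] by (auto intro!: fps_ext)
  qed
qed

lemma f_series_ex1: "\<exists>!f. is_f_series n f"
  unfolding is_f_series_def
  by (rule half_series_ex1) (use one_plus_xi_power_nonzero in auto)

lemma is_f_series_f_series: "is_f_series n (f_series n)"
  unfolding f_series_def by (rule theI'[OF f_series_ex1])


section \<open>Generators and relations\<close>

datatype sgn = Pos | Neg

fun sg :: "sgn \<Rightarrow> int" where
  "sg Pos = 1"
| "sg Neg = -1"

fun opp :: "sgn \<Rightarrow> sgn" where
  "opp Pos = Neg"
| "opp Neg = Pos"

text \<open>\<open>XS s i k\<close> stands for \<open>X\<^bsup>s\<^esup>\<^bsub>i,k\<^esub>\<close>, \<open>HS s i m\<close> for \<open>h\<^bsup>s\<^esup>\<^bsub>i,sm\<^esub>\<close> (so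
  \<open>HS Neg i m\<close> is \<open>h\<^sup>-\<^bsub>i,-m\<^esub>\<close>) and \<open>CS s\<close> for \<open>q\<^bsup>s c/2\<^esup>\<close>.\<close>

datatype symbol = XS sgn nat int | HS sgn nat nat | CS sgn

fun in_range :: "nat \<Rightarrow> symbol \<Rightarrow> bool" where
  "in_range n (XS s i k) \<longleftrightarrow> 1 \<le> i \<and> i \<le> n"
| "in_range n (HS s i m) \<longleftrightarrow> 1 \<le> i \<and> i \<le> n + 1"
| "in_range n (CS s) \<longleftrightarrow> True"

text \<open>The algebra is made a type of its own, with the rank encoded as the cardinality of a finite
  type: \<open>n = CARD('n)\<close>. Thus \<open>n \<ge> 1\<close> is automatic. The generators are the symbols whose index
  lies in the range determined by \<open>n\<close>.\<close>

typedef (overloaded) ('n::finite) generator = "{x. in_range CARD('n) x}"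
  by (rule exI[of _ "CS Pos"]) simp

text \<open>
  A formal series in \<open>u\<^sup>\<plusminus>\<^sup>1\<close> is a function \<open>int \<Rightarrow> 'a\<close> sending \<open>a\<close> to the coefficient of
  \<open>u\<^sup>a\<close>; one in \<open>u\<^sup>\<plusminus>\<^sup>1, v\<^sup>\<plusminus>\<^sup>1\<close> sends \<open>a, b\<close> to the coefficient of \<open>u\<^sup>a v\<^sup>b\<close>. One-sided series,
  which lie in \<open>'a[[u]]\<close> or in \<open>'a[[u\<^sup>-\<^sup>1]]\<close>, are also written as elements of \<open>'a fps\<close>, whose
  variable then is \<open>u\<^sup>s\<close> for a sign \<open>s\<close>.
\<close>

definition two_sided :: "sgn \<Rightarrow> 'a::zero fps \<Rightarrow> int \<Rightarrow> 'a" where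
  "two_sided s A = (\<lambda>a. if 0 \<le> sg s * a then fps_nth A (nat (sg s * a)) else 0)"

text \<open>\<open>A(u) B(v)\<close> and \<open>B(v) A(u)\<close>.\<close>

definition prod_uv :: "(int \<Rightarrow> 'a::times) \<Rightarrow> (int \<Rightarrow> 'a) \<Rightarrow> int \<Rightarrow> int \<Rightarrow> 'a" where
  "prod_uv A B = (\<lambda>a b. A a * B b)"

definition prod_vu :: "(int \<Rightarrow> 'a::times) \<Rightarrow> (int \<Rightarrow> 'a) \<Rightarrow> int \<Rightarrow> int \<Rightarrow> 'a" where
  "prod_vu B A = (\<lambda>a b. B b * A a)"

text \<open>\<open>A(u) X(v) B(u)\<close> for \<open>A\<close>, \<open>B\<close> in \<open>'a[[u\<^sup>s]]\<close>.\<close>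

definition prod_uvu ::
  "sgn \<Rightarrow> 'a::{comm_monoid_add,times} fps \<Rightarrow> (int \<Rightarrow> 'a) \<Rightarrow> 'a fps \<Rightarrow> int \<Rightarrow> int \<Rightarrow> 'a" where
  "prod_uvu s A X B = (\<lambda>a b. if 0 \<le> sg s * a
     then \<Sum>k\<le>nat (sg s * a). fps_nth A k * X b * fps_nth B (nat (sg s * a) - k) else 0)"

definition only_v :: "(int \<Rightarrow> 'a::zero) \<Rightarrow> int \<Rightarrow> int \<Rightarrow> 'a" where
  "only_v X = (\<lambda>a b. if a = 0 then X b else 0)"

text \<open>\<open>r((u/v)\<^sup>s) D(u,v)\<close> for a power series \<open>r\<close>, where \<open>D(u,v)\<close> contains only nonnegative powers
  of \<open>u\<^sup>s\<close>: for this reason the sum over \<open>k\<close> may be cut off at \<open>s a\<close>.\<close>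

definition ratio_mult ::
  "sgn \<Rightarrow> 'a::{comm_monoid_add,times} fps \<Rightarrow> (int \<Rightarrow> int \<Rightarrow> 'a) \<Rightarrow> int \<Rightarrow> int \<Rightarrow> 'a" where
  "ratio_mult s r D = (\<lambda>a b. \<Sum>k\<le>nat (sg s * a).
     fps_nth r k * D (a - sg s * int k) (b + sg s * int k))"

text \<open>The expansion of \<open>(\<alpha>u - \<beta>v)/(\<gamma>u - \<delta>v)\<close> in nonnegative powers of \<open>(u/v)\<^sup>s\<close>.\<close>

definition expand :: "sgn \<Rightarrow> cq \<Rightarrow> cq \<Rightarrow> cq \<Rightarrow> cq \<Rightarrow> cq fps" where
  "expand s \<alpha> \<beta> \<gamma> \<delta> = (case s of
     Pos \<Rightarrow> (fps_const \<alpha> * fps_X - fps_const \<beta>) / (fps_const \<gamma> * fps_X - fps_const \<delta>)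
   | Neg \<Rightarrow> (fps_const \<alpha> - fps_const \<beta> * fps_X) / (fps_const \<gamma> - fps_const \<delta> * fps_X))"

text \<open>The relations make sense for any interpretation of the generators in a ring
  containing images of the scalars. They are stated in this generality, and used for the free
  algebra; the same vocabulary describes the series of the quotient algebra.\<close>

locale generators =
  fixes n :: nat
    and scal :: "cq \<Rightarrow> 'a::ring_1"
    and gen :: "symbol \<Rightarrow> 'a"
begin

definition Xser :: "sgn \<Rightarrow> nat \<Rightarrow> int \<Rightarrow> 'a" where
  "Xser s i = (\<lambda>a. gen (XS s i (- a)))"

text \<open>\<open>h\<^bsup>s\<^esup>\<^sub>i(u)\<close>, a power series in \<open>u\<^sup>s\<close>.\<close>

definition h :: "sgn \<Rightarrow> nat \<Rightarrow> 'a fps" where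
  "h s i = Abs_fps (\<lambda>m. gen (HS s i m))"

text \<open>\<open>h\<^bsup>s\<^esup>\<^sub>i(u)\<^sup>-\<^sup>1\<close>, computed recursively from the inverse \<open>h\<^bsup>-s\<^esup>\<^bsub>i,0\<^esub>\<close> of the constant term
  (an actual inverse as soon as \<open>h\<^sup>+\<^bsub>i,0\<^esub> h\<^sup>-\<^bsub>i,0\<^esub> = h\<^sup>-\<^bsub>i,0\<^esub> h\<^sup>+\<^bsub>i,0\<^esub> = 1\<close>, see \<open>hinv_inverse\<close>).\<close>

definition hinv :: "sgn \<Rightarrow> nat \<Rightarrow> 'a fps" where
  "hinv s i = fps_right_inverse (h s i) (fps_nth (h (opp s) i) 0)"

abbreviation hser :: "sgn \<Rightarrow> nat \<Rightarrow> int \<Rightarrow> 'a" where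
  "hser s i \<equiv> two_sided s (h s i)"

text \<open>\<open>qc e\<close> is \<open>q\<^bsup>e c/2\<^esup>\<close>.\<close>

definition qc :: "int \<Rightarrow> 'a" where
  "qc e = (if 0 \<le> e then gen (CS Pos) ^ nat e
           else gen (CS Neg) ^ nat (- e))"

text \<open>\<open>r(x q\<^bsup>e c/2\<^esup>)\<close> as a series in \<open>x\<close>.\<close>

definition rescale :: "int \<Rightarrow> cq fps \<Rightarrow> 'a fps" where
  "rescale e r = Abs_fps (\<lambda>k. qc (e * int k) * scal (fps_nth r k))"

text \<open>\<open>g((u q\<^bsup>e c/2\<^esup> / v)\<^sup>s)\<close> as a series in \<open>(u/v)\<^sup>s\<close>.\<close>

definition gfac :: "sgn \<Rightarrow> int \<Rightarrow> 'a fps" where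
  "gfac s e = rescale (sg s * e) (g_series n)"

text \<open>\<open>(\<alpha>u' - \<beta>v')/(\<gamma>u' - \<delta>v')\<close> with \<open>u' = u q\<^bsup>d c/2\<^esup>\<close> and \<open>v' = v q\<^bsup>e c/2\<^esup>\<close>, expanded in
  nonnegative powers of \<open>(u/v)\<^sup>s\<close>. The shift \<open>u\<^sub>\<plusminus>\<close> corresponds to \<open>d = \<plusminus>1\<close>.\<close>

definition rfac :: "sgn \<Rightarrow> int \<Rightarrow> int \<Rightarrow> cq \<Rightarrow> cq \<Rightarrow> cq \<Rightarrow> cq \<Rightarrow> 'a fps" where
  "rfac s d e \<alpha> \<beta> \<gamma> \<delta> = rescale (sg s * (d - e)) (expand s \<alpha> \<beta> \<gamma> \<delta>)"

text \<open>\<open>A(ut)\<close>\<close>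

definition shift :: "cq \<Rightarrow> (int \<Rightarrow> 'a) \<Rightarrow> int \<Rightarrow> 'a" where
  "shift t A = (\<lambda>a. scal (t powi a) * A a)"

text \<open>\<open>(\<alpha>u - \<beta>v) D(u,v)\<close>\<close>

definition lin_mult :: "cq \<Rightarrow> cq \<Rightarrow> (int \<Rightarrow> int \<Rightarrow> 'a) \<Rightarrow> int \<Rightarrow> int \<Rightarrow> 'a" where
  "lin_mult \<alpha> \<beta> D = (\<lambda>a b. scal \<alpha> * D (a - 1) b - scal \<beta> * D a (b - 1))"

text \<open>\<open>A(u q\<^bsup>e c/2\<^esup>)\<close>\<close>

definition qc_shift :: "int \<Rightarrow> (int \<Rightarrow> 'a) \<Rightarrow> int \<Rightarrow> 'a" where
  "qc_shift e A = (\<lambda>a. qc (e * a) * A a)"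

text \<open>\<open>\<delta>(u q\<^bsup>e c/2\<^esup> / v) A(v)\<close> and \<open>\<delta>(u q\<^bsup>e c/2\<^esup> / v) A(u)\<close>; only the summand
  \<open>(u q\<^bsup>e c/2\<^esup> / v)\<^sup>r\<close> with \<open>r = a\<close> resp. \<open>r = -b\<close> contributes to \<open>u\<^sup>a v\<^sup>b\<close>.\<close>

definition delta_v :: "int \<Rightarrow> (int \<Rightarrow> 'a) \<Rightarrow> int \<Rightarrow> int \<Rightarrow> 'a" where
  "delta_v e A = (\<lambda>a b. qc (e * a) * A (a + b))"

definition delta_u :: "int \<Rightarrow> (int \<Rightarrow> 'a) \<Rightarrow> int \<Rightarrow> int \<Rightarrow> 'a" where
  "delta_u e A = (\<lambda>a b. qc (- e * b) * A (a + b))"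

text \<open>The coefficient of \<open>u\<^sub>1\<^bsup>k 1\<^esup> \<dots> u\<^sub>r\<^bsup>k r\<^esup> v\<^sup>b\<close> in the left hand side of the Serre relation.\<close>

definition serre :: "sgn \<Rightarrow> nat \<Rightarrow> nat \<Rightarrow> nat \<Rightarrow> (nat \<Rightarrow> int) \<Rightarrow> int \<Rightarrow> 'a" where
  "serre s i j r k b = (\<Sum>\<pi> | \<pi> permutes {1..r}. \<Sum>l = 0..r.
     scal ((-1) ^ l * qbinom (qi n i) r l) *
     prod_list (map (\<lambda>t. Xser s i (k (\<pi> t))) [1..<l + 1]) * Xser s j b *
     prod_list (map (\<lambda>t. Xser s i (k (\<pi> t))) [l + 1..<r + 1]))"

text \<open>The defining relations, coefficient by coefficient.\<close>

inductive rel :: "'a \<Rightarrow> 'a \<Rightarrow> bool" where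
  c_central: "in_range n x \<Longrightarrow> rel (qc 1 * gen x) (gen x * qc 1)"
| c_inv_right: "rel (qc 1 * qc (-1)) 1"
| c_inv_left: "rel (qc (-1) * qc 1) 1"
| h_inv: "1 \<le> i \<Longrightarrow> i \<le> n + 1 \<Longrightarrow> rel (fps_nth (h s i) 0 * fps_nth (h (opp s) i) 0) 1"
| h_zero: "rel (fps_nth (h Pos n) 0 * fps_nth (h Pos (n + 1)) 0) 1"
| h_h_same_sign: "1 \<le> i \<Longrightarrow> i \<le> n + 1 \<Longrightarrow> 1 \<le> j \<Longrightarrow> j \<le> n + 1 \<Longrightarrow>
    rel (prod_uv (hser s i) (hser s j) a b) (prod_vu (hser s j) (hser s i) a b)"
| h_h_same_index: "1 \<le> i \<Longrightarrow> i \<le> n + 1 \<Longrightarrow>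
    rel (ratio_mult s (gfac s 2) (prod_uv (hser s i) (hser (opp s) i)) a b)
        (ratio_mult s (gfac s (-2)) (prod_vu (hser (opp s) i) (hser s i)) a b)"
| h_h_less: "1 \<le> i \<Longrightarrow> i < j \<Longrightarrow> j \<le> n + 1 \<Longrightarrow> i \<noteq> n \<Longrightarrow>
    rel (ratio_mult s (gfac s 2 * rfac s (sg s) (- sg s) 1 1 q (inverse q))
           (prod_uv (hser s i) (hser (opp s) j)) a b)
        (ratio_mult s (gfac s (-2) * rfac s (- sg s) (sg s) 1 1 q (inverse q))
           (prod_vu (hser (opp s) j) (hser s i)) a b)"
| h_h_last:
    "rel (ratio_mult s (gfac s 2 * rfac s (sg s) (- sg s) 1 1 (q powi 2) (q powi -2))
           (prod_uv (hser s n) (hser (opp s) (n + 1))) a b)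
        (ratio_mult s (gfac s (-2) * rfac s (- sg s) (sg s) 1 1 (q powi 2) (q powi -2))
           (prod_vu (hser (opp s) (n + 1)) (hser s n)) a b)"
| h_Xplus: "1 \<le> i \<Longrightarrow> i \<le> n \<Longrightarrow> 1 \<le> j \<Longrightarrow> j \<le> n \<Longrightarrow> e = ip n (eps i) (alpha n j) \<Longrightarrow>
    rel (prod_uv (hser s i) (Xser Pos j) a b)
        (ratio_mult s (rfac s 0 (sg s) 1 1 (q powi e) (q powi (- e)))
           (prod_vu (Xser Pos j) (hser s i)) a b)"
| h_Xminus: "1 \<le> i \<Longrightarrow> i \<le> n \<Longrightarrow> 1 \<le> j \<Longrightarrow> j \<le> n \<Longrightarrow> e = ip n (eps i) (alpha n j) \<Longrightarrow>
    rel (prod_uv (hser s i) (Xser Neg j) a b)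
        (ratio_mult s (rfac s (sg s) 0 (q powi e) (q powi (- e)) 1 1)
           (prod_vu (Xser Neg j) (hser s i)) a b)"
| hlast_Xplus_n:
    "rel (prod_uv (hser s (n + 1)) (Xser Pos n) a b)
        (ratio_mult s (rfac s (- sg s) 0 1 1 (q powi -2) (q powi 2))
           (prod_vu (Xser Pos n) (hser s (n + 1))) a b)"
| hlast_Xminus_n:
    "rel (prod_uv (hser s (n + 1)) (Xser Neg n) a b)
        (ratio_mult s (rfac s (sg s) 0 (q powi -2) (q powi 2) 1 1)
           (prod_vu (Xser Neg n) (hser s (n + 1))) a b)"
| hlast_Xplus_pred: "2 \<le> n \<Longrightarrow>
    rel (prod_uvu s (hinv s (n + 1)) (Xser Pos (n - 1)) (h s (n + 1)) a b)
        (ratio_mult s (rfac s 0 (sg s) (inverse q) q (q powi -2) (q powi 2))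
           (only_v (Xser Pos (n - 1))) a b)"
| hlast_Xminus_pred: "2 \<le> n \<Longrightarrow>
    rel (prod_uvu s (h s (n + 1)) (Xser Neg (n - 1)) (hinv s (n + 1)) a b)
        (ratio_mult s (rfac s 0 (- sg s) (inverse q) q (q powi -2) (q powi 2))
           (only_v (Xser Neg (n - 1))) a b)"
| hlast_X: "1 \<le> i \<Longrightarrow> i + 2 \<le> n \<Longrightarrow>
    rel (prod_uv (hser s (n + 1)) (Xser t i) a b) (prod_vu (Xser t i) (hser s (n + 1)) a b)"
| X_X: "1 \<le> i \<Longrightarrow> i < n \<Longrightarrow> 1 \<le> j \<Longrightarrow> j < n \<Longrightarrow> e = sg s * ip n (alpha n i) (alpha n j) \<Longrightarrow>
    rel (lin_mult 1 (q powi e) (prod_uv (shift (q ^ i) (Xser s i)) (shift (q ^ j) (Xser s j))) a b)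
        (lin_mult (q powi e) 1 (prod_vu (shift (q ^ j) (Xser s j)) (shift (q ^ i) (Xser s i))) a b)"
| X_Xn: "1 \<le> i \<Longrightarrow> i < n \<Longrightarrow> e = sg s * ip n (alpha n i) (alpha n n) \<Longrightarrow>
    rel (lin_mult 1 (q powi e)
           (prod_uv (shift (q ^ i) (Xser s i)) (shift (q ^ (n + 1)) (Xser s n))) a b)
        (lin_mult (q powi e) 1
           (prod_vu (shift (q ^ (n + 1)) (Xser s n)) (shift (q ^ i) (Xser s i))) a b)"
| Xn_Xn: "e = sg s * ip n (alpha n n) (alpha n n) \<Longrightarrow>
    rel (lin_mult 1 (q powi e) (prod_uv (Xser s n) (Xser s n)) a b)
        (lin_mult (q powi e) 1 (prod_vu (Xser s n) (Xser s n)) a b)"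
| Xplus_Xminus: "1 \<le> i \<Longrightarrow> i \<le> n \<Longrightarrow> 1 \<le> j \<Longrightarrow> j \<le> n \<Longrightarrow>
    rel (prod_uv (Xser Pos i) (Xser Neg j) a b - prod_vu (Xser Neg j) (Xser Pos i) a b)
        (if i = j then scal (qi n i - inverse (qi n i)) *
           (delta_v (-2) (qc_shift 1 (two_sided Neg (hinv Neg i * h Neg (i + 1)))) a b -
            delta_u 2 (qc_shift 1 (two_sided Pos (hinv Pos i * h Pos (i + 1)))) a b)
         else 0)"
| serre: "1 \<le> i \<Longrightarrow> i \<le> n \<Longrightarrow> 1 \<le> j \<Longrightarrow> j \<le> n \<Longrightarrow> i \<noteq> j \<Longrightarrow> r = nat (1 - cartan n i j) \<Longrightarrow>
    rel (serre s i j r k b) 0"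

lemma hinv_inverse:
  assumes "\<And>s. fps_nth (h s i) 0 * fps_nth (h (opp s) i) 0 = 1"
  shows "h s i * hinv s i = 1" "hinv s i * h s i = 1"
proof -
  have "fps_nth (h (opp s) i) 0 * fps_nth (h s i) 0 = 1"
    using assms[of "opp s"] by (cases s) auto
  thus "h s i * hinv s i = 1" "hinv s i * h s i = 1"
    unfolding hinv_def using assms[of s] by (auto intro: fps_right_inverse fps_left_inverse')
qed

text \<open>\<open>A(ut)\<close> for a power series \<open>A(u)\<close> in \<open>u\<^sup>s\<close>.\<close>

definition fps_shift_arg :: "sgn \<Rightarrow> cq \<Rightarrow> 'a fps \<Rightarrow> 'a fps" where
  "fps_shift_arg s t A = Abs_fps (\<lambda>m. scal (t powi (sg s * int m)) * fps_nth A m)"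

definition z :: "sgn \<Rightarrow> 'a fps" where
  "z s = prod_list (map (\<lambda>i. fps_shift_arg s (xi n * q powi (2 * int i)) (hinv s i)) [1..<n]) *
         prod_list (map (\<lambda>i. fps_shift_arg s (xi n * q powi (2 * int i - 2)) (h s i)) [1..<n + 1]) *
         h s (n + 1)"

end


subsection \<open>Naturality of the relations\<close>

locale generators_hom =
  A: generators n scal gen + B: generators n scal' gen'
  for n :: nat and scal :: "cq \<Rightarrow> 'a::ring_1" and gen :: "symbol \<Rightarrow> 'a"
    and scal' :: "cq \<Rightarrow> 'b::ring_1" and gen' :: "symbol \<Rightarrow> 'b" +
  fixes \<phi> :: "'a \<Rightarrow> 'b"
  assumes add: "\<phi> (x + y) = \<phi> x + \<phi> y"
    and mult: "\<phi> (x * y) = \<phi> x * \<phi> y"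
    and one: "\<phi> 1 = 1"
    and scal: "\<phi> (scal c) = scal' c"
    and gen: "\<phi> (gen w) = gen' w"
begin

lemma zero: "\<phi> 0 = 0"
  using add[of 0 0] by simp

lemma minus: "\<phi> (- x) = - \<phi> x"
  using add[of x "- x"] by (simp add: zero eq_neg_iff_add_eq_0 add.commute)

lemma diff: "\<phi> (x - y) = \<phi> x - \<phi> y"
  using add[of x "- y"] by (simp add: minus)

lemma sum: "\<phi> (sum f S) = (\<Sum>x\<in>S. \<phi> (f x))"
  by (induction S rule: infinite_finite_induct) (auto simp: zero add)

lemma power: "\<phi> (x ^ m) = \<phi> x ^ m"
  by (induction m) (auto simp: one mult)

lemma prod_list: "\<phi> (prod_list xs) = prod_list (map \<phi> xs)"
  by (induction xs) (auto simp: one mult)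

lemma h: "\<phi> (fps_nth (A.h s i) m) = fps_nth (B.h s i) m"
  by (simp add: A.h_def B.h_def gen)

lemma hinv: "\<phi> (fps_nth (A.hinv s i) m) = fps_nth (B.hinv s i) m"
proof -
  have "\<phi> (fps_right_inverse_constructor (A.h s i) (fps_nth (A.h (opp s) i) 0) m) =
        fps_right_inverse_constructor (B.h s i) (fps_nth (B.h (opp s) i) 0) m"
  proof (induction m rule: less_induct)
    case (less m)
    show ?case
    proof (cases m)
      case (Suc k)
      show ?thesis
        unfolding Suc fps_right_inverse_constructor.simps mult minus sum h
        by (intro arg_cong2[where f = "(*)"] sum.cong refl) (use less Suc in auto)
    qed (simp add: h)
  qed
  thus ?thesis by (simp add: A.hinv_def B.hinv_def)
qed

lemma Xser: "\<phi> (A.Xser s i a) = B.Xser s i a"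
  by (simp add: A.Xser_def B.Xser_def gen)

lemma qc: "\<phi> (A.qc e) = B.qc e"
  by (simp add: A.qc_def B.qc_def gen power)

lemma fps_mult:
  assumes "\<And>k. \<phi> (fps_nth r k) = fps_nth r' k" "\<And>k. \<phi> (fps_nth t k) = fps_nth t' k"
  shows "\<phi> (fps_nth (r * t) m) = fps_nth (r' * t') m"
  by (simp add: fps_mult_nth sum mult assms)

lemma rescale: "\<phi> (fps_nth (A.rescale e r) k) = fps_nth (B.rescale e r) k"
  by (simp add: A.rescale_def B.rescale_def mult qc scal)

lemma gfac: "\<phi> (fps_nth (A.gfac s e) k) = fps_nth (B.gfac s e) k"
  by (simp add: A.gfac_def B.gfac_def rescale)

lemma rfac: "\<phi> (fps_nth (A.rfac s d e \<alpha> \<beta> \<gamma> \<delta>) k) = fps_nth (B.rfac s d e \<alpha> \<beta> \<gamma> \<delta>) k"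
  by (simp add: A.rfac_def B.rfac_def rescale)

lemma two_sided:
  assumes "\<And>k. \<phi> (fps_nth r k) = fps_nth r' k"
  shows "\<phi> (two_sided s r a) = two_sided s r' a"
  by (simp add: two_sided_def assms zero)

lemma hser: "\<phi> (A.hser s i a) = B.hser s i a"
  by (rule two_sided) (rule h)

lemma prod_uv:
  assumes "\<And>a. \<phi> (X a) = X' a" "\<And>a. \<phi> (Y a) = Y' a"
  shows "\<phi> (prod_uv X Y a b) = prod_uv X' Y' a b" "\<phi> (prod_vu X Y a b) = prod_vu X' Y' a b"
  by (simp_all add: prod_uv_def prod_vu_def mult assms)

lemma prod_uvu:
  assumes "\<And>k. \<phi> (fps_nth r k) = fps_nth r' k" "\<And>a. \<phi> (X a) = X' a"
    "\<And>k. \<phi> (fps_nth t k) = fps_nth t' k"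
  shows "\<phi> (prod_uvu s r X t a b) = prod_uvu s r' X' t' a b"
  by (simp add: prod_uvu_def mult sum zero assms)

lemma only_v:
  assumes "\<And>a. \<phi> (X a) = X' a"
  shows "\<phi> (only_v X a b) = only_v X' a b"
  by (simp add: only_v_def zero assms)

lemma ratio_mult:
  assumes "\<And>k. \<phi> (fps_nth r k) = fps_nth r' k" "\<And>a b. \<phi> (D a b) = D' a b"
  shows "\<phi> (ratio_mult s r D a b) = ratio_mult s r' D' a b"
  by (simp add: ratio_mult_def mult sum assms)

lemma shift:
  assumes "\<And>a. \<phi> (X a) = X' a"
  shows "\<phi> (A.shift t X a) = B.shift t X' a"
  by (simp add: A.shift_def B.shift_def mult scal assms)

lemma qc_shift:
  assumes "\<And>a. \<phi> (X a) = X' a"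
  shows "\<phi> (A.qc_shift e X a) = B.qc_shift e X' a"
  by (simp add: A.qc_shift_def B.qc_shift_def mult qc assms)

lemma delta:
  assumes "\<And>a. \<phi> (X a) = X' a"
  shows "\<phi> (A.delta_v e X a b) = B.delta_v e X' a b" "\<phi> (A.delta_u e X a b) = B.delta_u e X' a b"
  by (simp_all add: A.delta_v_def B.delta_v_def A.delta_u_def B.delta_u_def mult qc assms)

lemma lin_mult:
  assumes "\<And>a b. \<phi> (D a b) = D' a b"
  shows "\<phi> (A.lin_mult \<alpha> \<beta> D a b) = B.lin_mult \<alpha> \<beta> D' a b"
  by (simp add: A.lin_mult_def B.lin_mult_def mult scal diff assms)

lemma serre: "\<phi> (A.serre s i j r k b) = B.serre s i j r k b"
  by (simp add: A.serre_def B.serre_def mult scal sum prod_list Xser o_def)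

lemma mult': "\<phi> x = x' \<Longrightarrow> \<phi> y = y' \<Longrightarrow> \<phi> (x * y) = x' * y'"
  by (simp add: mult)

lemmas transport = mult' one zero diff scal gen qc h hser Xser serre
  prod_uv prod_uvu only_v ratio_mult shift qc_shift delta lin_mult
  fps_mult gfac rfac hinv two_sided

lemma rel:
  assumes "A.rel x y" shows "B.rel (\<phi> x) (\<phi> y)"
proof -
  have eqI: "B.rel x' y' \<Longrightarrow> \<phi> x = x' \<Longrightarrow> \<phi> y = y' \<Longrightarrow> B.rel (\<phi> x) (\<phi> y)" for x y x' y'
    by simp
  show ?thesis
    using assms
  proof cases
    case (Xplus_Xminus i j a b)
    have *: "\<phi> (fps_nth (A.hinv t i * A.h t (i + 1)) k) = fps_nth (B.hinv t i * B.h t (i + 1)) k"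
      for t k by (rule fps_mult[OF hinv h])
    have d: "\<phi> (A.delta_v e (A.qc_shift d (two_sided t (A.hinv t i * A.h t (i + 1)))) a b) =
          B.delta_v e (B.qc_shift d (two_sided t (B.hinv t i * B.h t (i + 1)))) a b"
        "\<phi> (A.delta_u e (A.qc_shift d (two_sided t (A.hinv t i * A.h t (i + 1)))) a b) =
          B.delta_u e (B.qc_shift d (two_sided t (B.hinv t i * B.h t (i + 1)))) a b" for t d e
      by (intro delta qc_shift two_sided *)+
    have "\<phi> y = (if i = j then scal' (qi n i - inverse (qi n i)) *
        (B.delta_v (-2) (B.qc_shift 1 (two_sided Neg (B.hinv Neg i * B.h Neg (i + 1)))) a b -
         B.delta_u 2 (B.qc_shift 1 (two_sided Pos (B.hinv Pos i * B.h Pos (i + 1)))) a b)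
         else 0)"
      unfolding Xplus_Xminus(2)
      by (simp only: mult scal diff zero d if_distrib[of \<phi>])
    moreover have "\<phi> x = prod_uv (B.Xser Pos i) (B.Xser Neg j) a b -
        prod_vu (B.Xser Neg j) (B.Xser Pos i) a b"
      unfolding Xplus_Xminus(1) by (simp add: diff prod_uv[OF Xser Xser])
    ultimately show ?thesis
      using B.Xplus_Xminus[OF Xplus_Xminus(3-6)] by simp
  next
    case c_central
    show ?thesis unfolding c_central(1,2)
      by (rule eqI[OF B.c_central[OF c_central(3)]]) (simp_all add: mult qc gen)
  next
    case c_inv_right
    show ?thesis unfolding c_inv_right(1,2)
      by (rule eqI[OF B.c_inv_right]; (fact c_inv_right | intro transport))
  next
    case c_inv_left
    show ?thesis unfolding c_inv_left(1,2)
      by (rule eqI[OF B.c_inv_left]; (fact c_inv_left | intro transport))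
  next
    case (h_inv i s)
    show ?thesis unfolding h_inv(1,2)
      by (rule eqI[OF B.h_inv[where i = i and s = s]]; (fact h_inv | intro transport))
  next
    case h_zero
    show ?thesis unfolding h_zero(1,2)
      by (rule eqI[OF B.h_zero]; (fact h_zero | intro transport))
  next
    case (h_h_same_sign i j s a b)
    show ?thesis unfolding h_h_same_sign(1,2)
      by (rule eqI[OF B.h_h_same_sign[where i = i and j = j and s = s and a = a and b = b]]; (fact h_h_same_sign | intro transport))
  next
    case (h_h_same_index i s a b)
    show ?thesis unfolding h_h_same_index(1,2)
      by (rule eqI[OF B.h_h_same_index[where i = i and s = s and a = a and b = b]]; (fact h_h_same_index | intro transport))
  next
    case (h_h_less i j s a b)
    show ?thesis unfolding h_h_less(1,2)
      by (rule eqI[OF B.h_h_less[where i = i and j = j and s = s and a = a and b = b]]; (fact h_h_less | intro transport))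
  next
    case (h_h_last s a b)
    show ?thesis unfolding h_h_last(1,2)
      by (rule eqI[OF B.h_h_last[where s = s and a = a and b = b]]; (fact h_h_last | intro transport))
  next
    case (h_Xplus i j e s a b)
    show ?thesis unfolding h_Xplus(1,2)
      by (rule eqI[OF B.h_Xplus[where i = i and j = j and e = e and s = s and a = a and b = b]]; (fact h_Xplus | intro transport))
  next
    case (h_Xminus i j e s a b)
    show ?thesis unfolding h_Xminus(1,2)
      by (rule eqI[OF B.h_Xminus[where i = i and j = j and e = e and s = s and a = a and b = b]]; (fact h_Xminus | intro transport))
  next
    case (hlast_Xplus_n s a b)
    show ?thesis unfolding hlast_Xplus_n(1,2)
      by (rule eqI[OF B.hlast_Xplus_n[where s = s and a = a and b = b]]; (fact hlast_Xplus_n | intro transport))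
  next
    case (hlast_Xminus_n s a b)
    show ?thesis unfolding hlast_Xminus_n(1,2)
      by (rule eqI[OF B.hlast_Xminus_n[where s = s and a = a and b = b]]; (fact hlast_Xminus_n | intro transport))
  next
    case (hlast_Xplus_pred s a b)
    show ?thesis unfolding hlast_Xplus_pred(1,2)
      by (rule eqI[OF B.hlast_Xplus_pred[where s = s and a = a and b = b]]; (fact hlast_Xplus_pred | intro transport))
  next
    case (hlast_Xminus_pred s a b)
    show ?thesis unfolding hlast_Xminus_pred(1,2)
      by (rule eqI[OF B.hlast_Xminus_pred[where s = s and a = a and b = b]]; (fact hlast_Xminus_pred | intro transport))
  next
    case (hlast_X i s t a b)
    show ?thesis unfolding hlast_X(1,2)
      by (rule eqI[OF B.hlast_X[where i = i and s = s and t = t and a = a and b = b]]; (fact hlast_X | intro transport))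
  next
    case (X_X i j e s a b)
    show ?thesis unfolding X_X(1,2)
      by (rule eqI[OF B.X_X[where i = i and j = j and e = e and s = s and a = a and b = b]]; (fact X_X | intro transport))
  next
    case (X_Xn i e s a b)
    show ?thesis unfolding X_Xn(1,2)
      by (rule eqI[OF B.X_Xn[where i = i and e = e and s = s and a = a and b = b]]; (fact X_Xn | intro transport))
  next
    case (Xn_Xn e s a b)
    show ?thesis unfolding Xn_Xn(1,2)
      by (rule eqI[OF B.Xn_Xn[where e = e and s = s and a = a and b = b]]; (fact Xn_Xn | intro transport))
  next
    case (serre i j r s k b)
    show ?thesis unfolding serre(1,2)
      by (rule eqI[OF B.serre[where i = i and j = j and r = r and s = s and k = k and b = b]]; (fact serre | intro transport))
  qed
qed

end


section \<open>The algebra\<close>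

text \<open>Words form a monoid under concatenation, and the free algebra is its monoid algebra.\<close>

datatype 'g fword = FWord (letters: "'g list")

instantiation fword :: (type) monoid_add
begin

definition zero_fword :: "'a fword" where
  "zero_fword = FWord []"

definition plus_fword :: "'a fword \<Rightarrow> 'a fword \<Rightarrow> 'a fword" where
  "plus_fword v w = FWord (letters v @ letters w)"

instance
  by standard (auto simp: zero_fword_def plus_fword_def)

end

type_synonym 'n free_alg = "'n generator fword \<Rightarrow>\<^sub>0 cq"

definition free_scal :: "cq \<Rightarrow> ('n::finite) free_alg" where
  "free_scal c = Poly_Mapping.single 0 c"

definition free_gen :: "symbol \<Rightarrow> ('n::finite) free_alg" where
  "free_gen x = Poly_Mapping.single (FWord [Abs_generator x]) 1"

definition free_rel :: "('n::finite) free_alg \<Rightarrow> 'n free_alg \<Rightarrow> bool" where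
  "free_rel = generators.rel CARD('n) free_scal free_gen"

text \<open>The two-sided ideal generated by the relations.\<close>

inductive rel_ideal :: "('n::finite) free_alg \<Rightarrow> bool" where
  zero: "rel_ideal 0"
| step: "rel_ideal x \<Longrightarrow> free_rel l r \<Longrightarrow> rel_ideal (x + a * (l - r) * b)"

lemma rel_ideal_add: "rel_ideal x \<Longrightarrow> rel_ideal y \<Longrightarrow> rel_ideal (y + x)"
proof (induction rule: rel_ideal.induct)
  case (step x l r a b)
  thus ?case using rel_ideal.step[of "y + x" l r a b] by (simp add: add.assoc)
qed simp

lemma rel_ideal_mult: "rel_ideal x \<Longrightarrow> rel_ideal (c * x * d)"
proof (induction rule: rel_ideal.induct)
  case (step x l r a b)
  thus ?case using rel_ideal.step[of "c * x * d" l r "c * a" "b * d"]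
    by (simp add: distrib_left distrib_right mult.assoc)
qed (simp add: rel_ideal.zero)

lemma rel_ideal_minus: "rel_ideal x \<Longrightarrow> rel_ideal (- x)"
  using rel_ideal_mult[of x "-1" 1] by simp


subsection \<open>The relations do not generate the unit ideal\<close>

text \<open>This is witnessed by the character \<open>X\<^bsup>s\<^esup>\<^bsub>i,k\<^esub> \<mapsto> 0\<close>, \<open>h\<^bsup>s\<^esup>\<^sub>i(u) \<mapsto> 1\<close>,
  \<open>q\<^bsup>c/2\<^esup> \<mapsto> 1\<close>.\<close>

fun triv_char :: "symbol \<Rightarrow> cq" where
  "triv_char (XS s i k) = 0"
| "triv_char (HS s i m) = (if m = 0 then 1 else 0)"
| "triv_char (CS s) = 1"

lemma triv_char_rel:
  assumes rel: "generators.rel n (\<lambda>c. c) f x y"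
    and f: "\<And>w. in_range n w \<Longrightarrow> f w = triv_char w" and n: "1 \<le> n"
  shows "x = y"
proof -
  interpret generators n "\<lambda>c. c" f .
  have X: "Xser s i = (\<lambda>_. 0)" if "1 \<le> i" "i \<le> n" for s i
    using that by (auto simp: Xser_def f)
  have h: "h s i = 1" if "1 \<le> i" "i \<le> n + 1" for s i
    using that by (auto simp: h_def f fps_eq_iff)
  have hinv: "hinv s i = 1" if "1 \<le> i" "i \<le> n + 1" for s i
    unfolding hinv_def h[OF that] by (simp add: fps_lr_inverse_one_one)
  have qc: "qc e = 1" for e
    by (simp add: qc_def f)
  have rescale: "rescale e r = r" for e r
    by (simp add: rescale_def qc fps_eq_iff)
  have vu: "prod_vu A B = prod_uv B A" for A B :: "int \<Rightarrow> cq"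
    by (simp add: prod_vu_def prod_uv_def mult.commute)
  have zero: "prod_uv A (\<lambda>_. 0) a b = 0" "prod_uv (\<lambda>_. 0) A a b = 0"
      "prod_uvu s r (\<lambda>_. 0) t a b = 0" "only_v (\<lambda>_. 0) a b = (0 :: cq)"
    for A :: "int \<Rightarrow> cq" and a b s and r t :: "cq fps"
    by (auto simp: prod_uv_def prod_uvu_def only_v_def)
  from rel show ?thesis
  proof cases
    case (serre i j r s k b)
    thus ?thesis by (simp add: serre_def X)
  qed (use n in \<open>auto simp: X h hinv qc vu zero gfac_def rfac_def rescale ratio_mult_def
        lin_mult_def shift_def delta_v_def delta_u_def qc_shift_def two_sided_def\<close>)
qed

definition word_char :: "('n::finite) generator fword \<Rightarrow> cq" where
  "word_char w = prod_list (map (\<lambda>x. triv_char (Rep_generator x)) (letters w))"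

definition free_char :: "('n::finite) free_alg \<Rightarrow> cq" where
  "free_char p = (\<Sum>w\<in>Poly_Mapping.keys p. Poly_Mapping.lookup p w * word_char w)"

lemma free_char_superset:
  assumes "finite S" "Poly_Mapping.keys p \<subseteq> S"
  shows "free_char p = (\<Sum>w\<in>S. Poly_Mapping.lookup p w * word_char w)"
  unfolding free_char_def using assms
  by (intro sum.mono_neutral_left) (auto simp: in_keys_iff)

lemma free_char_add: "free_char (x + y) = free_char x + free_char y"
proof -
  let ?S = "Poly_Mapping.keys x \<union> Poly_Mapping.keys y"
  have "free_char z = (\<Sum>w\<in>?S. Poly_Mapping.lookup z w * word_char w)" if "z \<in> {x, y, x + y}" for z
    using that keys_add[of x y] by (intro free_char_superset) auto
  thus ?thesis by (simp add: lookup_add distrib_right sum.distrib)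
qed

lemma free_char_zero: "free_char 0 = 0"
  by (simp add: free_char_def)

lemma free_char_sum: "free_char (sum f S) = (\<Sum>x\<in>S. free_char (f x))"
  by (induction S rule: infinite_finite_induct) (auto simp: free_char_zero free_char_add)

lemma free_char_single: "free_char (Poly_Mapping.single w c) = c * word_char w"
  by (simp add: free_char_def)

lemma free_alg_expand:
  fixes p :: "('n::finite) free_alg"
  shows "p = (\<Sum>w\<in>Poly_Mapping.keys p. Poly_Mapping.single w (Poly_Mapping.lookup p w))"
  by (rule poly_mapping_eqI) (auto simp: lookup_sum lookup_single when_def in_keys_iff)

lemma free_char_mult: "free_char (x * y) = free_char x * free_char y"
proof -
  have "free_char (x * y) = (\<Sum>v\<in>Poly_Mapping.keys x. \<Sum>w\<in>Poly_Mapping.keys y.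
      free_char (Poly_Mapping.single v (Poly_Mapping.lookup x v) *
                 Poly_Mapping.single w (Poly_Mapping.lookup y w)))"
    by (subst free_alg_expand[of x], subst free_alg_expand[of y])
       (simp add: sum_product free_char_sum)
  also have "\<dots> = free_char x * free_char y"
    unfolding free_char_def sum_product
    by (intro sum.cong refl)
       (simp add: mult_single free_char_single[unfolded free_char_def] word_char_def plus_fword_def)
  finally show ?thesis .
qed

lemma free_char_one: "free_char (1 :: ('n::finite) free_alg) = 1"
proof -
  have "free_char (Poly_Mapping.single 0 1 :: ('n::finite) free_alg) = 1"
    unfolding free_char_single by (simp add: word_char_def zero_fword_def)
  thus "free_char (1 :: 'n free_alg) = 1" by simp
qed

lemma free_rel_char:
  fixes l r :: "('n::finite) free_alg"
  assumes "free_rel l r"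
  shows "free_char l = free_char r"
proof -
  let ?f = "\<lambda>x. triv_char (Rep_generator (Abs_generator x :: 'n generator))"
  interpret generators_hom "CARD('n)" free_scal "free_gen :: symbol \<Rightarrow> 'n free_alg"
    "\<lambda>c. c" ?f free_char
    by standard (auto simp: free_char_add free_char_mult free_char_one free_scal_def free_gen_def
        free_char_single word_char_def zero_fword_def)
  have "generators.rel CARD('n) (\<lambda>c. c) ?f (free_char l) (free_char r)"
    using assms unfolding free_rel_def by (rule rel)
  thus ?thesis
    by (rule triv_char_rel) (auto simp: Abs_generator_inverse Suc_le_eq)
qed

lemma one_not_in_rel_ideal: "\<not> rel_ideal (1 :: ('n::finite) free_alg)"
proof -
  have diff: "free_char (x - y) = free_char x - free_char y" for x y :: "'n free_alg"
    using free_char_add[of "x - y" y] by simp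
  have "free_char x = 0" if "rel_ideal x" for x :: "'n free_alg"
    using that
    by induction (auto simp: free_char_zero free_char_add free_char_mult diff free_rel_char)
  thus ?thesis using free_char_one[where 'n = 'n] by force
qed


subsection \<open>The quotient\<close>

text \<open>\<open>'n uext\<close> is the extended quantum affine algebra of type \<open>C\<^sub>n\<close>, with \<open>n = CARD('n)\<close>.\<close>

quotient_type (overloaded) 'n uext = "('n::finite) free_alg" / "\<lambda>x y. rel_ideal (x - y)"
proof (rule equivpI)
  show "reflp (\<lambda>x y :: 'n free_alg. rel_ideal (x - y))"
    by (auto intro!: reflpI rel_ideal.zero)
  show "symp (\<lambda>x y :: 'n free_alg. rel_ideal (x - y))"
  proof (rule sympI)
    fix x y :: "'n free_alg" assume "rel_ideal (x - y)"
    from rel_ideal_minus[OF this] show "rel_ideal (y - x)" by simp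
  qed
  show "transp (\<lambda>x y :: 'n free_alg. rel_ideal (x - y))"
  proof (rule transpI)
    fix x y z :: "'n free_alg" assume "rel_ideal (x - y)" "rel_ideal (y - z)"
    from rel_ideal_add[OF this] show "rel_ideal (x - z)" by simp
  qed
qed

instantiation uext :: (finite) ring_1
begin

lift_definition zero_uext :: "'a uext" is 0 .

lift_definition one_uext :: "'a uext" is 1 .

lift_definition plus_uext :: "'a uext \<Rightarrow> 'a uext \<Rightarrow> 'a uext" is "(+)"
proof -
  fix x x' y y' :: "'a free_alg"
  assume "rel_ideal (x - x')" "rel_ideal (y - y')"
  from rel_ideal_add[OF this] show "rel_ideal (x + y - (x' + y'))" by (simp add: algebra_simps)
qed

lift_definition uminus_uext :: "'a uext \<Rightarrow> 'a uext" is uminus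
proof -
  fix x y :: "'a free_alg"
  assume "rel_ideal (x - y)"
  from rel_ideal_minus[OF this] show "rel_ideal (- x - - y)" by simp
qed

lift_definition minus_uext :: "'a uext \<Rightarrow> 'a uext \<Rightarrow> 'a uext" is "(-)"
proof -
  fix x x' y y' :: "'a free_alg"
  assume "rel_ideal (x - x')" "rel_ideal (y - y')"
  hence "rel_ideal ((x - x') + - (y - y'))" by (intro rel_ideal_add rel_ideal_minus)
  thus "rel_ideal (x - y - (x' - y'))" by (simp add: algebra_simps)
qed

lift_definition times_uext :: "'a uext \<Rightarrow> 'a uext \<Rightarrow> 'a uext" is "(*)"
proof -
  fix x x' y y' :: "'a free_alg"
  assume "rel_ideal (x - x')" "rel_ideal (y - y')"
  hence "rel_ideal (1 * (x - x') * y + x' * (y - y') * 1)"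
    by (intro rel_ideal_add rel_ideal_mult)
  thus "rel_ideal (x * y - x' * y')" by (simp add: algebra_simps)
qed

instance
proof
  have eq: "rel_ideal (x - y)" if "x = y" for x y :: "'a free_alg"
    using that by (simp add: rel_ideal.zero)
  fix x y z :: "'a uext"
  show "x + y + z = x + (y + z)" "x + y = y + x" "0 + x = x" "- x + x = 0" "x - y = x + - y"
    "x * y * z = x * (y * z)" "1 * x = x" "x * 1 = x"
    "(x + y) * z = x * z + y * z" "x * (y + z) = x * y + x * z"
    by (transfer, rule eq, simp add: algebra_simps)+
  have "\<not> rel_ideal (0 - 1 :: 'a free_alg)"
    using one_not_in_rel_ideal rel_ideal_minus[of "0 - 1"] by auto
  thus "(0 :: 'a uext) \<noteq> 1"
    by transfer
qed

end

definition uext_scal :: "cq \<Rightarrow> ('n::finite) uext" where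
  "uext_scal c = abs_uext (free_scal c)"

definition uext_gen :: "symbol \<Rightarrow> ('n::finite) uext" where
  "uext_gen x = abs_uext (free_gen x)"

lemma free_rel_uext_eq: "free_rel l r \<Longrightarrow> abs_uext l = abs_uext r"
  using rel_ideal.step[OF rel_ideal.zero, of l r 1 1] by (simp add: uext.abs_eq_iff)

lemma uext_generators_hom:
  "generators_hom free_scal free_gen uext_scal uext_gen (abs_uext :: _ \<Rightarrow> ('n::finite) uext)"
  by standard (simp_all add: plus_uext.abs_eq times_uext.abs_eq one_uext.abs_eq
      uext_scal_def uext_gen_def)

lemma uext_h_zero_inverse:
  assumes "1 \<le> i" "i \<le> CARD('n) + 1"
  shows "fps_nth (generators.h uext_gen s i) 0 * fps_nth (generators.h uext_gen (opp s) i) 0 =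
    (1 :: ('n::finite) uext)"
proof -
  interpret generators_hom "CARD('n)" free_scal free_gen uext_scal uext_gen
    "abs_uext :: _ \<Rightarrow> 'n uext" by (rule uext_generators_hom)
  have "free_rel (fps_nth (A.h s i) 0 * fps_nth (A.h (opp s) i) 0) 1"
    unfolding free_rel_def by (rule A.h_inv[OF assms])
  from free_rel_uext_eq[OF this] show ?thesis
    by (simp only: mult one h)
qed

lemma uext_h_hinv:
  assumes "1 \<le> i" "i \<le> CARD('n) + 1"
  shows "generators.h uext_gen s i * generators.hinv uext_gen s i = (1 :: ('n::finite) uext fps)"
    "generators.hinv uext_gen s i * generators.h uext_gen s i = (1 :: 'n uext fps)"
  by (rule generators.hinv_inverse, rule uext_h_zero_inverse[OF assms])+

text \<open>\<open>z\<^sup>+(u)\<close> as a power series in \<open>u\<close>, and \<open>z\<^sup>-(u)\<close> as a power series in \<open>u\<^sup>-\<^sup>1\<close>.\<close>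

definition uext_z :: "sgn \<Rightarrow> ('n::finite) uext fps" where
  "uext_z = generators.z CARD('n) uext_scal uext_gen"

definition central :: "'a::times \<Rightarrow> bool" where
  "central x \<longleftrightarrow> (\<forall>y. x * y = y * x)"

end

theory Submission
  imports Defs
begin

text \<open>
  Each \<open>h\<^sub>i(u)\<close> can be moved past any generating series \<open>Y(v)\<close> at the cost of a factor
  \<open>\<Psi>(r)/\<Phi>(r)\<close>, where \<open>r\<close> is a power series in \<open>u/v\<close> over \<open>\<complex>(q)\<close> and the homomorphisms \<open>\<Phi>\<close>, \<open>\<Psi>\<close>
  rescale its argument by powers of \<open>q\<^bsup>c/2\<^esup>\<close>. The series \<open>r\<close> is multiplicative in the series on the
  left, so that of \<open>z(u)\<close> is an explicit product. For \<open>Y = X\<^sub>j\<close> it equals \<open>1\<close>. For \<open>h\<^sub>j\<close> of the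
  opposite sign the product telescopes to \<open>g(x) g(x\<xi>)\<close> (or the inverse of \<open>g(x) g(x\<xi>\<^sup>-\<^sup>1)\<close>) times a
  rational function of degree \<open>0\<close>, and the functional equation of \<open>f\<close> reduces this to a constant, on
  which \<open>\<Phi>\<close> and \<open>\<Psi>\<close> agree.
\<close>

section \<open>Exchange relations between series\<close>

definition central_fps :: "'a::ring_1 fps \<Rightarrow> bool" where
  "central_fps F \<longleftrightarrow> (\<forall>k. central (fps_nth F k))"

lemma central_mult: "central x \<Longrightarrow> central y \<Longrightarrow> central (x * y :: 'a::ring_1)"
  unfolding central_def by (metis mult.assoc)

lemma central_power: "central x \<Longrightarrow> central (x ^ k :: 'a::ring_1)"
  by (induction k) (auto simp: central_mult central_def[of 1])

lemma central_sum: "(\<And>x. x \<in> S \<Longrightarrow> central (f x)) \<Longrightarrow> central (sum f S :: 'a::ring_1)"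
  by (simp add: central_def sum_distrib_left sum_distrib_right)

lemma central_fps_mult: "central_fps F \<Longrightarrow> central_fps G \<Longrightarrow> central_fps (F * G)"
  by (auto simp: central_fps_def fps_mult_nth intro!: central_sum central_mult)

lemma central_fps_one: "central_fps 1"
  by (auto simp: central_fps_def central_def)

lemma fps_mult_nth_rev: "fps_nth (F * G) m = (\<Sum>i=0..m. fps_nth F (m - i) * fps_nth G i)"
  unfolding fps_mult_nth
  by (rule sum.reindex_bij_witness[of _ "\<lambda>i. m - i" "\<lambda>i. m - i"]) auto

lemma central_fps_commute:
  assumes "central_fps F" shows "F * G = G * (F :: 'a::ring_1 fps)"
proof (rule fps_ext)
  fix m
  show "fps_nth (F * G) m = fps_nth (G * F) m"
    unfolding fps_mult_nth[of F G] fps_mult_nth_rev[of G F]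
    by (intro sum.cong refl) (use assms in \<open>auto simp: central_fps_def central_def\<close>)
qed

text \<open>The part of \<open>A(u) Y(v)\<close> of total degree \<open>N\<close>, read as a power
  series in \<open>(u/v)^s\<close>, so that multiplication by a factor in \<open>(u/v)^s\<close>
  becomes an ordinary product of power series.\<close>

definition slice_left :: "sgn \<Rightarrow> 'a::times fps \<Rightarrow> (int \<Rightarrow> 'a) \<Rightarrow> int \<Rightarrow> 'a fps" where
  "slice_left s A Y N = Abs_fps (\<lambda>i. fps_nth A i * Y (N - sg s * int i))"

definition slice_right :: "sgn \<Rightarrow> 'a::times fps \<Rightarrow> (int \<Rightarrow> 'a) \<Rightarrow> int \<Rightarrow> 'a fps" where
  "slice_right s A Y N = Abs_fps (\<lambda>i. Y (N - sg s * int i) * fps_nth A i)"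

text \<open>\<open>P((u/v)\<^sup>s) A(u) Y(v) = Q((u/v)\<^sup>s) Y(v) A(u)\<close>. A factor in \<open>u/v\<close> does not change the total
  degree \<open>N\<close> in \<open>u\<close> and \<open>v\<close>, so the equation is stated separately for each \<open>N\<close>.\<close>

definition exchange ::
  "sgn \<Rightarrow> 'a::ring_1 fps \<Rightarrow> (int \<Rightarrow> 'a) \<Rightarrow> 'a fps \<Rightarrow> 'a fps \<Rightarrow> bool" where
  "exchange s A Y P Q \<longleftrightarrow> (\<forall>N. P * slice_left s A Y N = Q * slice_right s A Y N)"

text \<open>\<open>P((u/v)\<^sup>s) Y(v)\<close>, as the family of its coefficients of \<open>v\<^sup>b\<close> for fixed \<open>b\<close>, each of which is a
  power series in \<open>u\<^sup>s\<close>. In this form both sides of an exchange relation are products of power series.\<close>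

definition twist :: "sgn \<Rightarrow> 'a::ring_1 fps \<Rightarrow> (int \<Rightarrow> 'a) \<Rightarrow> int \<Rightarrow> 'a fps" where
  "twist s P Y b = Abs_fps (\<lambda>k. fps_nth P k * Y (b + sg s * int k))"

text \<open>Both sides are the coefficient of \<open>u^(sm) v^b\<close>, which lies in total degree
  \<open>b + sg s * int m\<close>. Centrality lets the coefficients of \<open>P\<close> pass to the
  left of those of \<open>A\<close>.\<close>

lemma nth_mult_twist:
  assumes "central_fps P"
  shows "fps_nth (A * twist s P Y b) m = fps_nth (P * slice_left s A Y (b + sg s * int m)) m"
proof -
  have "fps_nth A (m - i) * (fps_nth P i * Y (b + sg s * int i)) =
      fps_nth P i * (fps_nth A (m - i) * Y (b + sg s * int m - sg s * int (m - i)))"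
    if "i \<in> {0..m}" for i
  proof -
    have "fps_nth A (m - i) * fps_nth P i = fps_nth P i * fps_nth A (m - i)"
      using assms by (simp add: central_fps_def central_def)
    moreover have "b + sg s * int m - sg s * int (m - i) = b + sg s * int i"
      using that by (simp add: of_nat_diff algebra_simps)
    ultimately show ?thesis by (simp only: mult.assoc[symmetric])
  qed
  thus ?thesis
    unfolding fps_mult_nth_rev[of A] fps_mult_nth[of P]
    by (auto simp: twist_def slice_left_def intro!: sum.cong)
qed

lemma nth_twist_mult:
  "fps_nth (twist s Q Y b * A) m = fps_nth (Q * slice_right s A Y (b + sg s * int m)) m"
proof -
  have "fps_nth Q i * Y (b + sg s * int i) * fps_nth A (m - i) =
      fps_nth Q i * (Y (b + sg s * int m - sg s * int (m - i)) * fps_nth A (m - i))"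
    if "i \<in> {0..m}" for i
  proof -
    have "b + sg s * int m - sg s * int (m - i) = b + sg s * int i"
      using that by (simp add: of_nat_diff algebra_simps)
    thus ?thesis by (simp only: mult.assoc)
  qed
  thus ?thesis
    unfolding fps_mult_nth by (simp add: twist_def slice_right_def)
qed

text \<open>Since \<open>b = N - sg s * int m\<close>, comparing coefficients for all
  \<open>(N, m)\<close> amounts to comparing them for all \<open>(b, m)\<close>.\<close>

lemma exchange_iff_twist:
  assumes "central_fps P"
  shows "exchange s A Y P Q \<longleftrightarrow> (\<forall>b. A * twist s P Y b = twist s Q Y b * A)"
proof
  assume "exchange s A Y P Q"
  thus "\<forall>b. A * twist s P Y b = twist s Q Y b * A"
    by (auto simp: exchange_def fps_eq_iff nth_mult_twist[OF assms] nth_twist_mult)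
next
  assume *: "\<forall>b. A * twist s P Y b = twist s Q Y b * A"
  show "exchange s A Y P Q"
    unfolding exchange_def
  proof (intro allI fps_ext)
    fix N m
    show "fps_nth (P * slice_left s A Y N) m = fps_nth (Q * slice_right s A Y N) m"
      using nth_mult_twist[OF assms, of A s Y "N - sg s * int m" m]
        nth_twist_mult[of s Q Y "N - sg s * int m" A m] * by simp
  qed
qed

lemma exchange_scale: "exchange s A Y P Q \<Longrightarrow> exchange s A Y (R * P) (R * Q)"
  by (simp add: exchange_def mult.assoc)

text \<open>In the twisted form \<open>B\<close> and then \<open>A\<close> are moved past the
  series. The two relations are first scaled so that they meet in the same series,
  \<open>Y(v)\<close> with the factor \<open>P * Q'\<close>.\<close>

lemma exchange_mult:
  assumes "exchange s A Y P Q" "exchange s B Y P' Q'"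
    and c: "central_fps P" "central_fps Q" "central_fps P'" "central_fps Q'"
  shows "exchange s (A * B) Y (P * P') (Q * Q')"
  unfolding exchange_iff_twist[OF central_fps_mult[OF c(1,3)]]
proof
  fix b
  have 1: "exchange s B Y (P * P') (P * Q')"
    using assms(2) by (rule exchange_scale)
  have 2: "exchange s A Y (P * Q') (Q * Q')"
    using exchange_scale[OF assms(1), of Q'] c by (simp add: central_fps_commute)
  have "A * B * twist s (P * P') Y b = A * (twist s (P * Q') Y b * B)"
    using 1 c unfolding mult.assoc by (simp add: exchange_iff_twist central_fps_mult)
  also have "\<dots> = twist s (Q * Q') Y b * A * B"
    using 2 c by (simp add: exchange_iff_twist central_fps_mult flip: mult.assoc)
  finally show "A * B * twist s (P * P') Y b = twist s (Q * Q') Y b * (A * B)"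
    by (simp add: mult.assoc)
qed

lemma exchange_one: "exchange s 1 Y 1 1"
  by (simp add: exchange_def slice_left_def slice_right_def fps_eq_iff)

text \<open>Multiplying the twisted relation by \<open>B\<close> on both sides makes
  \<open>P\<close> and \<open>Q\<close> trade places.\<close>

lemma exchange_inverse:
  assumes "exchange s A Y P Q" "A * B = 1" "B * A = 1" "central_fps P" "central_fps Q"
  shows "exchange s B Y Q P"
  unfolding exchange_iff_twist[OF assms(5)]
proof
  fix b
  have "B * twist s Q Y b = B * (twist s Q Y b * A) * B"
    using assms(2) by (simp add: mult.assoc)
  also have "\<dots> = B * (A * twist s P Y b) * B"
    using assms by (simp add: exchange_iff_twist)
  also have "\<dots> = twist s P Y b * B"
    using assms(3) by (simp flip: mult.assoc)
  finally show "B * twist s Q Y b = twist s P Y b * B" .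
qed

lemma exchange_cancel:
  assumes "exchange s A Y P P" "P' * P = 1"
  shows "fps_nth A m * Y b = Y b * fps_nth A m"
proof -
  have "exchange s A Y 1 1"
    using exchange_scale[OF assms(1), of P'] assms(2) by simp
  \<comment> \<open>In this total degree the \<open>m\<close>-th coefficients of the two slices are
    exactly the products to be compared.\<close>
  hence "fps_nth (slice_left s A Y (b + sg s * int m)) m =
      fps_nth (slice_right s A Y (b + sg s * int m)) m"
    by (simp add: exchange_def)
  thus ?thesis by (simp add: slice_left_def slice_right_def)
qed

lemma sg_mult_self [simp]: "sg s * sg s = 1"
  by (cases s) auto

lemma sg_square [simp]: "sg s * (sg s * x) = x"
  by (cases s) auto

text \<open>Links the coefficientwise relations to slices: the cut-off in \<open>ratio_mult\<close>
  is the range of the Cauchy product.\<close>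

lemma ratio_mult_prod_uv:
  "ratio_mult s P (prod_uv (two_sided s A) Y) (sg s * int m) (N - sg s * int m) =
    fps_nth (P * slice_left s A Y N) m"
  "ratio_mult s P (prod_vu Y (two_sided s A)) (sg s * int m) (N - sg s * int m) =
    fps_nth (P * slice_right s A Y N) m"
proof -
  have A: "two_sided s A (sg s * int m - sg s * int k) = fps_nth A (m - k)"
    and Y: "N - sg s * int m + sg s * int k = N - sg s * int (m - k)" if "k \<le> m" for k
    using that by (cases s; auto simp: two_sided_def nat_diff_distrib)+
  show "ratio_mult s P (prod_uv (two_sided s A) Y) (sg s * int m) (N - sg s * int m) =
      fps_nth (P * slice_left s A Y N) m"
    "ratio_mult s P (prod_vu Y (two_sided s A)) (sg s * int m) (N - sg s * int m) =
      fps_nth (P * slice_right s A Y N) m"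
    unfolding ratio_mult_def fps_mult_nth slice_left_def slice_right_def
    by (simp_all only: sg_square nat_int fps_nth_Abs_fps prod_uv_def prod_vu_def atLeast0AtMost,
        (rule sum.cong, rule refl, simp only: A Y atMost_iff)+)
qed

lemma exchangeI:
  assumes "\<And>a b. ratio_mult s P (prod_uv (two_sided s A) Y) a b =
    ratio_mult s Q (prod_vu Y (two_sided s A)) a b"
  shows "exchange s A Y P Q"
  unfolding exchange_def fps_eq_iff ratio_mult_prod_uv[symmetric] using assms by simp

lemma ratio_mult_one: "ratio_mult s 1 D a b = (D a b :: 'a::ring_1)"
proof -
  have "ratio_mult s 1 D a b = (\<Sum>k\<le>nat (sg s * a). if k = 0 then D a b else 0)"
    unfolding ratio_mult_def by (intro sum.cong) auto
  thus ?thesis by simp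
qed

lemma exchangeI':
  assumes "\<And>a b. prod_uv (two_sided s A) Y a b = ratio_mult s Q (prod_vu Y (two_sided s A)) a b"
  shows "exchange s A Y 1 Q"
  by (rule exchangeI) (simp add: assms ratio_mult_one)

text \<open>As \<open>A(u)\<close> and \<open>B(v)\<close> run in opposite directions, only
  \<open>k \<le> l\<close> contributes to the coefficient of \<open>u^(sm) v^(-sl)\<close>. The
  resulting sums treat \<open>m\<close> and \<open>l\<close> alike, which makes the two series
  interchangeable.\<close>

lemma exchange_two_sided_iff:
  "exchange s A (two_sided (opp s) B) P Q \<longleftrightarrow>
    (\<forall>m l. (\<Sum>k\<le>min m l. fps_nth P k * (fps_nth A (m - k) * fps_nth B (l - k))) =
           (\<Sum>k\<le>min m l. fps_nth Q k * (fps_nth B (l - k) * fps_nth A (m - k))))"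
proof -
  have B: "two_sided (opp s) B (sg s * int m - sg s * int l - sg s * int (m - k)) =
      (if k \<le> l then fps_nth B (l - k) else 0)" if "k \<le> m" for k m l
    using that by (cases s) (auto simp: two_sided_def of_nat_diff nat_diff_distrib)
  have "fps_nth (P * slice_left s A (two_sided (opp s) B) (sg s * int m - sg s * int l)) m =
      (\<Sum>k\<le>min m l. fps_nth P k * (fps_nth A (m - k) * fps_nth B (l - k)))"
    for P and m l
    unfolding fps_mult_nth slice_left_def fps_nth_Abs_fps
    by (rule sum.mono_neutral_cong_right) (auto simp: B simp del: of_nat_diff)
  moreover have "fps_nth (Q * slice_right s A (two_sided (opp s) B) (sg s * int m - sg s * int l)) m =
      (\<Sum>k\<le>min m l. fps_nth Q k * (fps_nth B (l - k) * fps_nth A (m - k)))"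
    for Q and m l
    unfolding fps_mult_nth slice_right_def fps_nth_Abs_fps
    by (rule sum.mono_neutral_cong_right) (auto simp: B simp del: of_nat_diff)
  moreover have "exchange s A (two_sided (opp s) B) P Q \<longleftrightarrow>
    (\<forall>m l. fps_nth (P * slice_left s A (two_sided (opp s) B) (sg s * int m - sg s * int l)) m =
      fps_nth (Q * slice_right s A (two_sided (opp s) B) (sg s * int m - sg s * int l)) m)"
  proof
    assume *: "\<forall>m l. fps_nth (P * slice_left s A (two_sided (opp s) B) (sg s * int m - sg s * int l)) m =
      fps_nth (Q * slice_right s A (two_sided (opp s) B) (sg s * int m - sg s * int l)) m"
    show "exchange s A (two_sided (opp s) B) P Q"
      unfolding exchange_def fps_eq_iff
    proof (intro allI)
      fix N m
      show "fps_nth (P * slice_left s A (two_sided (opp s) B) N) m =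
          fps_nth (Q * slice_right s A (two_sided (opp s) B) N) m"
      proof (cases "0 \<le> int m - sg s * N")
        case True
        define l where "l = nat (int m - sg s * N)"
        have "N = sg s * int m - sg s * int l"
          using True by (cases s) (auto simp: l_def)
        thus ?thesis using * by simp
      next
        \<comment> \<open>Here \<open>l\<close> would be negative: every coefficient of
          \<open>B\<close> that enters vanishes, and both sides are zero.\<close>
        case False
        have "two_sided (opp s) B (N - sg s * int i) = 0" if "i \<le> m" for i
          using that False by (cases s) (auto simp: two_sided_def)
        thus ?thesis
          unfolding fps_mult_nth slice_left_def slice_right_def by (simp del: of_nat_diff)
      qed
    qed
  qed (auto simp: exchange_def)
  ultimately show ?thesis by simp
qed

text \<open>As \<open>(u/v)^s = (v/u)^(-s)\<close>, reading the relation from the side of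
  \<open>B\<close> keeps both factors and interchanges only the two sides, and \<open>m\<close> with
  \<open>l\<close>.\<close>

lemma exchange_swap:
  assumes "exchange s A (two_sided (opp s) B) P Q"
  shows "exchange (opp s) B (two_sided s A) Q P"
proof -
  have opp: "opp (opp s) = s" by (cases s) auto
  have "(\<Sum>k\<le>min m l. fps_nth Q k * (fps_nth B (m - k) * fps_nth A (l - k))) =
        (\<Sum>k\<le>min m l. fps_nth P k * (fps_nth A (l - k) * fps_nth B (m - k)))" for m l
    using assms[unfolded exchange_two_sided_iff, rule_format, of l m]
    by (simp add: min.commute)
  thus ?thesis
    using exchange_two_sided_iff[of "opp s" B A Q P] unfolding opp by blast
qed


section \<open>Scalar exchange factors\<close>

abbreviation dilate :: "cq \<Rightarrow> cq fps \<Rightarrow> cq fps" where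
  "dilate c r \<equiv> r oo (fps_const c * fps_X)"

text \<open>Applied to \<open>r(x)\<close>, the homomorphisms below are \<open>r \<mapsto> r(x q\<^bsup>e c/2\<^esup>)\<close> or trivial.\<close>

locale scalar_homs =
  fixes scal :: "cq \<Rightarrow> 'a::ring_1" and \<Phi> \<Psi> :: "cq fps \<Rightarrow> 'a fps"
  assumes scal_mult: "scal (a * b) = scal a * scal b"
    and scal_central: "central (scal a)"
    and hom_one: "\<Phi> 1 = 1" "\<Psi> 1 = 1"
    and hom_mult: "\<Phi> (r * t) = \<Phi> r * \<Phi> t" "\<Psi> (r * t) = \<Psi> r * \<Psi> t"
    and hom_central: "central_fps (\<Phi> r)" "central_fps (\<Psi> r)"
    and hom_dilate: "fps_nth (\<Phi> (dilate c r)) k = scal (c ^ k) * fps_nth (\<Phi> r) k"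
      "fps_nth (\<Psi> (dilate c r)) k = scal (c ^ k) * fps_nth (\<Psi> r) k"
begin

text \<open>\<open>A(u) Y(v) = \<Phi>(r)\<^sup>-\<^sup>1 \<Psi>(r) Y(v) A(u)\<close>\<close>

definition swaps :: "sgn \<Rightarrow> 'a fps \<Rightarrow> (int \<Rightarrow> 'a) \<Rightarrow> cq fps \<Rightarrow> bool" where
  "swaps s A Y r \<longleftrightarrow> exchange s A Y (\<Phi> r) (\<Psi> r)"

text \<open>The defining relations may spread numerator \<open>a\<close> and denominator
  \<open>b\<close> over both sides. Multiplying by the images of \<open>inverse b\<close> under both
  homomorphisms, which are central, collects them in one fraction.\<close>

lemma swapsI:
  assumes "exchange s A Y (\<Phi> a * \<Psi> b) (\<Phi> b * \<Psi> a)" "fps_nth b 0 \<noteq> 0"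
  shows "swaps s A Y (a * inverse b)"
proof -
  have inv: "\<Phi> (inverse b) * \<Phi> b = 1" "\<Psi> (inverse b) * \<Psi> b = 1"
    using assms(2) by (simp_all add: inverse_mult_eq_1 hom_one flip: hom_mult)
  have mid: "w * x * (y * t) = w * y * (x * t)" if "x * y = y * x" for w x y t :: "'a fps"
    using that by (metis mult.assoc)
  have "\<Phi> (inverse b) * \<Psi> (inverse b) * (\<Phi> a * \<Psi> b) =
      \<Phi> (inverse b) * \<Phi> a * (\<Psi> (inverse b) * \<Psi> b)"
    by (rule mid, rule central_fps_commute, rule hom_central)
  also have "\<dots> = \<Phi> (a * inverse b)"
    by (simp only: inv mult_1_right hom_mult(1)[symmetric] mult.commute[of a])
  finally have 1: "\<Phi> (inverse b) * \<Psi> (inverse b) * (\<Phi> a * \<Psi> b) = \<Phi> (a * inverse b)" .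
  have "\<Phi> (inverse b) * \<Psi> (inverse b) * (\<Phi> b * \<Psi> a) =
      (\<Phi> (inverse b) * \<Phi> b) * (\<Psi> (inverse b) * \<Psi> a)"
    by (rule mid, rule central_fps_commute, rule hom_central)
  also have "\<dots> = \<Psi> (a * inverse b)"
    by (simp only: inv mult_1_left hom_mult(2)[symmetric] mult.commute[of a])
  finally have 2: "\<Phi> (inverse b) * \<Psi> (inverse b) * (\<Phi> b * \<Psi> a) = \<Psi> (a * inverse b)" .
  show ?thesis
    using exchange_scale[OF assms(1), of "\<Phi> (inverse b) * \<Psi> (inverse b)"]
    unfolding swaps_def 1 2 .
qed

lemma swaps_one: "swaps s 1 Y 1"
  by (simp add: swaps_def hom_one exchange_one)

lemma swaps_mult: "swaps s A Y r \<Longrightarrow> swaps s B Y t \<Longrightarrow> swaps s (A * B) Y (r * t)"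
  by (simp add: swaps_def hom_mult exchange_mult hom_central)

lemma swaps_inverse:
  assumes "swaps s A Y r" "A * B = 1" "B * A = 1" "fps_nth r 0 \<noteq> 0"
  shows "swaps s B Y (inverse r)"
  using swapsI[of s B Y 1 r] exchange_inverse[OF assms(1)[unfolded swaps_def] assms(2,3)] assms(4)
  by (simp add: hom_one hom_central)

lemma swaps_prod_list:
  assumes "\<And>x. x \<in> set xs \<Longrightarrow> swaps s (f x) Y (r x)"
  shows "swaps s (prod_list (map f xs)) Y (prod_list (map r xs))"
  using assms by (induction xs) (auto simp: swaps_one swaps_mult)

text \<open>With \<open>c = t powi sg s\<close>, replacing \<open>u\<close> by \<open>ut\<close>
  multiplies the \<open>m\<close>-th coefficient of either side by \<open>scal (c ^ m)\<close>,
  provided that the factors are dilated by \<open>c\<close> as well.\<close>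

lemma swaps_fps_shift_arg:
  assumes "swaps s A Y r"
  shows "swaps s (generators.fps_shift_arg scal s t A) Y (dilate (t powi sg s) r)"
proof -
  define c where "c = t powi sg s"
  have "t powi (sg s * int m) = c ^ m" for m
    by (simp add: c_def power_int_mult)
  hence shift: "fps_nth (generators.fps_shift_arg scal s t A) m = scal (c ^ m) * fps_nth A m" for m
    by (simp add: generators.fps_shift_arg_def)
  have comm: "x * scal d = scal d * x" for x d
    using scal_central[of d] by (simp add: central_def)
  have split: "scal (c ^ k) * x * (scal (c ^ (m - k)) * y) = scal (c ^ m) * (x * y)"
    if "k \<le> m" for k m x y
  proof -
    have "scal (c ^ k) * x * (scal (c ^ (m - k)) * y) = scal (c ^ k) * (x * scal (c ^ (m - k))) * y"
      by (simp only: mult.assoc)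
    also have "\<dots> = scal (c ^ k) * scal (c ^ (m - k)) * (x * y)"
      by (simp only: comm[of x] mult.assoc)
    also have "scal (c ^ k) * scal (c ^ (m - k)) = scal (c ^ m)"
      using that by (simp flip: scal_mult power_add)
    finally show ?thesis .
  qed
  have left: "fps_nth (P' * slice_left s (generators.fps_shift_arg scal s t A) Y N) m =
      scal (c ^ m) * fps_nth (P * slice_left s A Y N) m"
    and right: "fps_nth (P' * slice_right s (generators.fps_shift_arg scal s t A) Y N) m =
      scal (c ^ m) * fps_nth (P * slice_right s A Y N) m"
    if "\<And>k. fps_nth P' k = scal (c ^ k) * fps_nth P k" for P P' N m
  proof -
    have l: "scal (c ^ k) * x * (scal (c ^ (m - k)) * y * w) = scal (c ^ m) * (x * (y * w))"
      and r: "scal (c ^ k) * x * (y * (scal (c ^ (m - k)) * w)) = scal (c ^ m) * (x * (y * w))"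
      if "k \<in> {0..m}" for k x y w
    proof -
      show "scal (c ^ k) * x * (scal (c ^ (m - k)) * y * w) = scal (c ^ m) * (x * (y * w))"
        using split[of k m x "y * w"] that by (simp add: mult.assoc)
      have "y * (scal (c ^ (m - k)) * w) = scal (c ^ (m - k)) * (y * w)"
        by (simp only: comm[of y] mult.assoc[symmetric])
      thus "scal (c ^ k) * x * (y * (scal (c ^ (m - k)) * w)) = scal (c ^ m) * (x * (y * w))"
        using split[of k m x "y * w"] that by simp
    qed
    show "fps_nth (P' * slice_left s (generators.fps_shift_arg scal s t A) Y N) m =
        scal (c ^ m) * fps_nth (P * slice_left s A Y N) m"
      "fps_nth (P' * slice_right s (generators.fps_shift_arg scal s t A) Y N) m =
        scal (c ^ m) * fps_nth (P * slice_right s A Y N) m"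
      unfolding fps_mult_nth slice_left_def slice_right_def fps_nth_Abs_fps shift that
        sum_distrib_left
      by (rule sum.cong, rule refl, erule l, rule sum.cong, rule refl, erule r)
  qed
  show ?thesis
    using assms unfolding swaps_def exchange_def fps_eq_iff c_def[symmetric]
    by (simp add: left[OF hom_dilate(1)] right[OF hom_dilate(2)])
qed

lemma swaps_cancel:
  assumes "swaps s A Y r" "\<Phi> r = \<Psi> r" "fps_nth r 0 \<noteq> 0"
  shows "fps_nth A m * Y b = Y b * fps_nth A m"
proof -
  have "\<Phi> (inverse r) * \<Phi> r = 1"
    using assms(3) by (simp add: inverse_mult_eq_1 hom_one flip: hom_mult)
  thus ?thesis
    using assms(1,2) exchange_cancel[of s A Y "\<Phi> r"] by (simp add: swaps_def)
qed

end


section \<open>Products of linear factors\<close>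

abbreviation qdilate :: "int \<Rightarrow> cq fps \<Rightarrow> cq fps" where
  "qdilate k \<equiv> dilate (q powi k)"

definition lin :: "int \<Rightarrow> cq fps" where
  "lin k = 1 - fps_const (q powi k) * fps_X"

definition linfrac :: "cq \<Rightarrow> int \<Rightarrow> int \<Rightarrow> cq fps" where
  "linfrac c k l = fps_const c * lin k * inverse (lin l)"

lemma lin_nth_0 [simp]: "fps_nth (lin k) 0 = 1"
  by (simp add: lin_def)

lemma linfrac_nth_0 [simp]: "fps_nth (linfrac c k l) 0 = c"
  by (simp add: linfrac_def)

lemma lin_inverse: "lin k * inverse (lin k) = 1"
  by (simp add: inverse_mult_eq_1')

lemma linfrac_same: "linfrac c k k = fps_const c"
  by (simp add: linfrac_def mult.assoc lin_inverse)

text \<open>The common factor \<open>lin l\<close> cancels; later products are reordered into such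
  chains.\<close>

lemma linfrac_chain: "linfrac c k l * linfrac d l m = linfrac (c * d) k m"
proof -
  have "linfrac c k l * linfrac d l m =
      fps_const c * fps_const d * lin k * inverse (lin m) * (lin l * inverse (lin l))"
    by (simp only: linfrac_def mult_ac)
  thus ?thesis by (simp add: lin_inverse linfrac_def)
qed

lemma linfrac_inverse: "c \<noteq> 0 \<Longrightarrow> inverse (linfrac c k l) = linfrac (inverse c) l k"
  by (simp add: linfrac_def fps_inverse_mult fps_const_inverse mult_ac)

lemma qdilate_mult: "qdilate k (a * b) = qdilate k a * qdilate k b"
  by (rule fps_compose_mult_distrib) simp

lemma qdilate_inverse: "fps_nth a 0 \<noteq> 0 \<Longrightarrow> qdilate k (inverse a) = inverse (qdilate k a)"
  by (rule fps_inverse_compose) auto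

lemma qdilate_qdilate: "qdilate k (qdilate l a) = qdilate (k + l) a"
  by (rule fps_ext) (simp only: fps_compose_linear, simp add: power_int_add power_mult_distrib)

lemma qdilate_nth_0 [simp]: "fps_nth (qdilate k a) 0 = fps_nth a 0"
  by (simp add: fps_compose_linear)

lemma qdilate_lin: "qdilate k (lin l) = lin (l + k)"
  by (simp add: lin_def fps_compose_sub_distrib qdilate_mult power_int_add mult.assoc
      flip: fps_const_mult)

lemma qdilate_linfrac: "qdilate k (linfrac c l m) = linfrac c (l + k) (m + k)"
  by (simp add: linfrac_def qdilate_mult qdilate_inverse qdilate_lin)

lemma expand_Pos:
  "expand Pos (q powi a) (q powi b) (q powi c) (q powi d) = linfrac (q powi (b - d)) (a - b) (c - d)"
proof -
  have *: "fps_const (q powi x) * fps_X - fps_const (q powi y) = fps_const (- (q powi y)) * lin (x - y)"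
    for x y
    by (auto simp: fps_eq_iff lin_def power_int_diff)
  have "fps_nth (fps_const (- (q powi d)) * lin (c - d)) 0 \<noteq> 0" by simp
  hence "expand Pos (q powi a) (q powi b) (q powi c) (q powi d) =
      fps_const (- (q powi b)) * lin (a - b) * inverse (fps_const (- (q powi d)) * lin (c - d))"
    unfolding expand_def * by (simp add: fps_divide_unit)
  also have "\<dots> = fps_const (- (q powi b)) * inverse (fps_const (- (q powi d))) * lin (a - b) *
      inverse (lin (c - d))"
    by (simp add: fps_inverse_mult mult_ac)
  also have "fps_const (- (q powi b)) * inverse (fps_const (- (q powi d))) =
      fps_const (q powi (b - d))"
    by (simp add: fps_const_inverse power_int_diff divide_simps)
  finally show ?thesis by (simp add: linfrac_def)
qed

lemma expand_Neg:
  "expand Neg (q powi a) (q powi b) (q powi c) (q powi d) = linfrac (q powi (a - c)) (b - a) (d - c)"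
proof -
  have *: "fps_const (q powi x) - fps_const (q powi y) * fps_X = fps_const (q powi x) * lin (y - x)"
    for x y
    by (auto simp: fps_eq_iff lin_def power_int_diff)
  have "fps_nth (fps_const (q powi c) * lin (d - c)) 0 \<noteq> 0" by simp
  hence "expand Neg (q powi a) (q powi b) (q powi c) (q powi d) =
      fps_const (q powi a) * lin (b - a) * inverse (fps_const (q powi c) * lin (d - c))"
    unfolding expand_def * by (simp add: fps_divide_unit)
  also have "\<dots> = fps_const (q powi a) * inverse (fps_const (q powi c)) * lin (b - a) *
      inverse (lin (d - c))"
    by (simp add: fps_inverse_mult mult_ac)
  also have "fps_const (q powi a) * inverse (fps_const (q powi c)) = fps_const (q powi (a - c))"
    by (simp add: fps_const_inverse power_int_diff divide_simps)
  finally show ?thesis by (simp add: linfrac_def)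
qed

text \<open>Reversing the direction of expansion negates all exponents, so one formula in
  \<open>sg s * e\<close> covers both signs.\<close>

lemma expand_sym:
  "expand s 1 1 (q powi e) (q powi (- e)) = linfrac (q powi (sg s * e)) 0 (2 * sg s * e)"
  using expand_Pos[of 0 0 e "- e"] expand_Neg[of 0 0 e "- e"] by (cases s) simp_all

lemma expand_sym_inverse:
  "expand s (q powi e) (q powi (- e)) 1 1 = inverse (linfrac (q powi (sg s * e)) 0 (2 * sg s * e))"
  using expand_Pos[of e "- e" 0 0] expand_Neg[of e "- e" 0 0]
  by (cases s) (simp_all add: linfrac_inverse power_int_minus)

lemma expand_pred:
  "expand s (inverse q) q (q powi -2) (q powi 2) =
    linfrac (q powi (- sg s)) (- 2 * sg s) (- 4 * sg s)"
  using expand_Pos[of "-1" 1 "-2" 2] expand_Neg[of "-1" 1 "-2" 2]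
  by (cases s) (simp_all add: power_int_minus)

lemma g_series_nth_0: "fps_nth (g_series n) 0 \<noteq> 0"
  using is_f_series_f_series[of n] by (simp add: g_series_def is_f_series_def)

text \<open>Four of the eight linear factors of \<open>(x - q\<^sup>-\<^sup>2)(x - \<xi>)(x\<xi> - q\<^sup>-\<^sup>2)(x\<xi> - \<xi>)\<close> and of the
  denominator of \<open>f(x) f(x\<xi>)\<close> cancel.\<close>

lemma g_series_dilate:
  "\<exists>c. c \<noteq> 0 \<and> g_series n * qdilate (- 2 * int n - 2) (g_series n) =
    linfrac c (- 2 * int n) (- 2 * int n - 2) * linfrac 1 0 (-2)"
proof -
  define N where "N = 2 * int n"
  define f where "f = f_series n"
  \<comment> \<open>The quadratic factor of \<open>g\<close> has constant term
    \<open>q powi -2 * xi n\<close>, which dilation preserves; \<open>c\<close> is the product of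
    the two copies.\<close>
  define c where "c = q powi -2 * xi n * (q powi -2 * xi n)"
  have xi: "xi n = q powi (- N - 2)"
    by (simp add: xi_def N_def)
  have *: "fps_X - fps_const (q powi y) = fps_const (- (q powi y)) * lin (- y)" for y
    by (auto simp: fps_eq_iff lin_def power_int_minus)
  have f: "f * qdilate (- N - 2) f = inverse (lin (-2) * lin 2 * lin (- N - 2) * lin (N + 2))"
  proof -
    have "inverse (q powi (- N - 2)) = q powi (N + 2)"
      by (simp flip: power_int_minus add: add.commute)
    thus ?thesis
      using is_f_series_f_series[of n]
      unfolding is_f_series_def f_def[symmetric] xi lin_def by metis
  qed
  have g: "g_series n = f * (fps_const (q powi -2 * xi n) * lin 2 * lin (N + 2))"
    unfolding g_series_def xi * f_def[symmetric] by (simp add: mult_ac add.commute)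
  have c: "fps_const (q powi -2 * xi n) * fps_const (q powi -2 * xi n) = fps_const c"
    by (simp add: c_def)
  \<comment> \<open>Dilation by \<open>xi n\<close> turns \<open>lin 2\<close> and
    \<open>lin (N + 2)\<close> into \<open>lin (- N)\<close> and \<open>lin 0\<close>.\<close>
  have "g_series n * qdilate (- N - 2) (g_series n) =
      (f * qdilate (- N - 2) f) * fps_const c * lin 2 * lin (N + 2) * lin (- N) * lin 0"
    unfolding g qdilate_mult qdilate_lin fps_const_compose c[symmetric] by (simp add: mult_ac)
  also have "\<dots> = fps_const c * lin (- N) * inverse (lin (- N - 2)) * (lin 0 * inverse (lin (-2))) *
      (lin 2 * inverse (lin 2)) * (lin (N + 2) * inverse (lin (N + 2)))"
    unfolding f by (simp add: fps_inverse_mult mult_ac)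
  also have "\<dots> = linfrac c (- N) (- N - 2) * linfrac 1 0 (-2)"
    by (simp add: lin_inverse linfrac_def)
  finally show ?thesis
    unfolding N_def by (intro exI[of _ c]) (simp_all add: c_def)
qed


section \<open>The exchange factor of \<open>z\<close>\<close>

text \<open>\<open>(\<xi> q\<^bsup>2i\<^esup>)\<^sup>s = q\<^bsup>shift_exp s n i\<^esup>\<close>\<close>

definition shift_exp :: "sgn \<Rightarrow> nat \<Rightarrow> int \<Rightarrow> int" where
  "shift_exp s n i = sg s * (2 * i - 2 * int n - 2)"

text \<open>The factor that \<open>z(u)\<close> acquires when each \<open>h_i(u)\<close> has factor
  \<open>r i\<close>. Scalar series commute, so the products can be indexed by sets.\<close>

definition z_factor :: "sgn \<Rightarrow> nat \<Rightarrow> (nat \<Rightarrow> cq fps) \<Rightarrow> cq fps" where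
  "z_factor s n r = (\<Prod>i=1..<n. inverse (qdilate (shift_exp s n (int i)) (r i))) *
     (\<Prod>i=1..<n + 1. qdilate (shift_exp s n (int i - 1)) (r i)) * r (n + 1)"

lemma z_factor_mult: "z_factor s n (\<lambda>i. r i * t i) = z_factor s n r * z_factor s n t"
  unfolding z_factor_def qdilate_mult fps_inverse_mult prod.distrib by (simp only: mult_ac)

lemma z_factor_nth_0:
  assumes "\<And>i. 1 \<le> i \<Longrightarrow> i \<le> n + 1 \<Longrightarrow> fps_nth (r i) 0 \<noteq> 0"
  shows "fps_nth (z_factor s n r) 0 \<noteq> 0"
proof -
  have nth_0: "fps_nth (prod f S) 0 = (\<Prod>x\<in>S. fps_nth (f x) 0)" for f :: "nat \<Rightarrow> cq fps" and S
    by (induction S rule: infinite_finite_induct) auto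
  show ?thesis
    using assms by (auto simp: z_factor_def nth_0 simp del: prod.op_ivl_Suc)
qed

text \<open>For \<open>i < n\<close> the two occurrences of \<open>h_i\<close> in \<open>z\<close>
  are paired. The single \<open>h_n\<close> has argument \<open>u q^(-4)\<close>, because
  \<open>xi q^(2n-2) = q^(-4)\<close>.\<close>

lemma z_factor_regroup:
  assumes "1 \<le> n"
  shows "z_factor s n r = (\<Prod>i=1..<n. qdilate (shift_exp s n (int i - 1)) (r i) *
      inverse (qdilate (shift_exp s n (int i)) (r i))) * qdilate (- 4 * sg s) (r n) * r (n + 1)"
proof -
  have "shift_exp s n (int n - 1) = - 4 * sg s"
    by (simp add: shift_exp_def)
  moreover have "{1..<n + 1} = insert n {1..<n}"
    using assms by auto
  ultimately show ?thesis
    unfolding z_factor_def prod.distrib by (simp add: mult_ac)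
qed

text \<open>The denominator at \<open>i\<close> and the numerator at \<open>i + 1\<close> are the
  same dilation of \<open>F\<close>.\<close>

lemma telescope:
  assumes "fps_nth F 0 \<noteq> 0" "1 \<le> l" "l \<le> m"
  shows "(\<Prod>i=l..<m. qdilate (shift_exp s n (int i - 1)) F * inverse (qdilate (shift_exp s n (int i)) F)) =
    qdilate (shift_exp s n (int l - 1)) F * inverse (qdilate (shift_exp s n (int m - 1)) F)"
  using assms(3)
proof (induction m rule: dec_induct)
  case base
  show ?case using assms(1) by (simp add: inverse_mult_eq_1')
next
  case (step m)
  have inv: "inverse (qdilate k F) * qdilate k F = 1" for k
    using assms(1) by (simp add: inverse_mult_eq_1)
  have "(\<Prod>i=l..<Suc m. qdilate (shift_exp s n (int i - 1)) F * inverse (qdilate (shift_exp s n (int i)) F)) =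
      qdilate (shift_exp s n (int l - 1)) F *
      (inverse (qdilate (shift_exp s n (int m - 1)) F) * qdilate (shift_exp s n (int m - 1)) F) *
      inverse (qdilate (shift_exp s n (int m)) F)"
    using step by (simp add: mult.assoc)
  thus ?case by (simp add: inv)
qed

text \<open>The factors of \<open>h\<^sub>i(u)\<close> against \<open>X\<^sub>j(v)\<close>, for \<open>1 \<le> i \<le> n + 1\<close>.\<close>

definition X_factor :: "sgn \<Rightarrow> nat \<Rightarrow> nat \<Rightarrow> nat \<Rightarrow> cq fps" where
  "X_factor s n j i =
     (if i \<le> n then linfrac (q powi (sg s * ip n (eps i) (alpha n j))) 0
        (2 * sg s * ip n (eps i) (alpha n j))
      else if j = n then linfrac (q powi (sg s * -2)) 0 (2 * sg s * -2)
      else if j + 1 = n then linfrac (q powi sg s) (- 4 * sg s) (- 2 * sg s)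
      else 1)"

lemma ip_eps:
  assumes "1 \<le> i" "i \<le> n" shows "ip n (eps i) x = x i"
proof -
  have "ip n (eps i) x = (\<Sum>k=1..n. if k = i then x k else 0)"
    unfolding ip_def eps_def by (intro sum.cong) auto
  thus ?thesis using assms by simp
qed

lemma ip_eps_alpha:
  assumes "1 \<le> i" "i \<le> n"
  shows "ip n (eps i) (alpha n j) =
    (if j < n then if i = j then 1 else if i = j + 1 then - 1 else 0 else if i = n then 2 else 0)"
  using assms by (simp add: ip_eps) (simp add: alpha_def eps_def)

text \<open>Only \<open>h_j\<close>, \<open>h_(j+1)\<close> and, for \<open>j \<ge> n - 1\<close>,
  also \<open>h_(n+1)\<close> have a nontrivial factor against \<open>X_j\<close>. Their shifted
  factors cancel in pairs; the cases differ in how \<open>h_n\<close> and \<open>h_(n+1)\<close>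
  take part.\<close>

lemma z_factor_X:
  assumes "1 \<le> j" "j \<le> n"
  shows "z_factor s n (X_factor s n j) = 1"
proof (cases "j = n")
  case True
  have one: "X_factor s n j i = 1" if "i \<in> {1..<n}" for i
    using that True by (simp add: X_factor_def ip_eps_alpha linfrac_same)
  have "(\<Prod>i=1..<n. qdilate (shift_exp s n (int i - 1)) (X_factor s n j i) *
      inverse (qdilate (shift_exp s n (int i)) (X_factor s n j i))) = 1"
    by (rule prod.neutral) (simp add: one)
  moreover have "X_factor s n j n = linfrac (q powi (2 * sg s)) 0 (4 * sg s)"
    "X_factor s n j (n + 1) = linfrac (q powi (- 2 * sg s)) 0 (- 4 * sg s)"
    using assms True by (simp_all add: X_factor_def ip_eps_alpha mult.commute)
  ultimately have "z_factor s n (X_factor s n j) =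
      linfrac (q powi (2 * sg s)) (- 4 * sg s) 0 * linfrac (q powi (- 2 * sg s)) 0 (- 4 * sg s)"
    using assms by (simp add: z_factor_regroup qdilate_linfrac)
  thus ?thesis
    by (simp add: linfrac_chain linfrac_same power_int_minus)
next
  case False
  let ?r = "X_factor s n j"
  let ?D = "\<lambda>i. qdilate (shift_exp s n (int i - 1)) (?r i) * inverse (qdilate (shift_exp s n (int i)) (?r i))"
  have e: "shift_exp s n (k - 1) = shift_exp s n k - 2 * sg s" for k
    by (simp add: shift_exp_def algebra_simps)
  have rj: "?r j = linfrac (q powi sg s) 0 (2 * sg s)"
    and rj1: "?r (j + 1) = linfrac (inverse (q powi sg s)) 0 (- 2 * sg s)" if "j + 1 \<le> n"
    using assms that by (auto simp: X_factor_def ip_eps_alpha power_int_minus)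
  have one: "?D i = 1" if "i \<in> {1..<n} - {j, j + 1}" for i
    using that False by (simp add: X_factor_def ip_eps_alpha linfrac_same)
  show ?thesis
  proof (cases "j + 1 = n")
    case True
    have "(\<Prod>i=1..<n. ?D i) = ?D j"
      using True assms one by (subst prod.mono_neutral_right[of _ "{j}"]) auto
    hence "z_factor s n ?r = ?D j * qdilate (- 4 * sg s) (?r n) * ?r (n + 1)"
      using assms by (simp add: z_factor_regroup)
    moreover have "shift_exp s n (int j) = - 4 * sg s"
      using True by (auto simp: shift_exp_def)
    moreover have "?r (n + 1) = linfrac (q powi sg s) (- 4 * sg s) (- 2 * sg s)"
      using True False by (simp add: X_factor_def)
    ultimately have "z_factor s n ?r =
        linfrac (q powi sg s) (- 6 * sg s) (- 4 * sg s) *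
        linfrac (inverse (q powi sg s)) (- 2 * sg s) (- 4 * sg s) *
        linfrac (inverse (q powi sg s)) (- 4 * sg s) (- 6 * sg s) *
        linfrac (q powi sg s) (- 4 * sg s) (- 2 * sg s)"
      using rj rj1 True by (simp add: e qdilate_linfrac linfrac_inverse)
    \<comment> \<open>Each bracket is now a chain that returns to the exponent it started
      from.\<close>
    also have "\<dots> = (linfrac (q powi sg s) (- 6 * sg s) (- 4 * sg s) *
        linfrac (inverse (q powi sg s)) (- 4 * sg s) (- 6 * sg s)) *
        (linfrac (inverse (q powi sg s)) (- 2 * sg s) (- 4 * sg s) *
        linfrac (q powi sg s) (- 4 * sg s) (- 2 * sg s))"
      by (simp only: mult_ac)
    also have "\<dots> = 1"
      by (simp add: linfrac_chain linfrac_same)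
    finally show ?thesis .
  next
    case ne: False
    define a where "a = shift_exp s n (int j)"
    have "(\<Prod>i=1..<n. ?D i) = (\<Prod>i\<in>{j, j + 1}. ?D i)"
      using ne False assms one by (intro prod.mono_neutral_right) auto
    moreover have "?r n = 1" "?r (n + 1) = 1"
      using ne False assms by (auto simp: X_factor_def ip_eps_alpha linfrac_same)
    ultimately have "z_factor s n ?r = ?D j * ?D (j + 1)"
      using assms by (simp add: z_factor_regroup)
    also have "shift_exp s n (int (j + 1)) = a + 2 * sg s"
      by (simp add: a_def shift_exp_def algebra_simps)
    also have "shift_exp s n (int (j + 1) - 1) = a"
      by (simp add: a_def)
    finally have "z_factor s n ?r =
        linfrac (q powi sg s) (a - 2 * sg s) a * linfrac (inverse (q powi sg s)) (a + 2 * sg s) a *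
        (linfrac (inverse (q powi sg s)) a (a - 2 * sg s) * linfrac (q powi sg s) a (a + 2 * sg s))"
      using rj rj1 ne False assms
      by (simp add: e qdilate_linfrac linfrac_inverse add.commute flip: a_def)
    also have "\<dots> = (linfrac (q powi sg s) (a - 2 * sg s) a *
        linfrac (inverse (q powi sg s)) a (a - 2 * sg s)) *
        (linfrac (inverse (q powi sg s)) (a + 2 * sg s) a * linfrac (q powi sg s) a (a + 2 * sg s))"
      by (simp only: mult_ac)
    also have "\<dots> = 1"
      by (simp add: linfrac_chain linfrac_same)
    finally show ?thesis .
  qed
qed

text \<open>The homomorphisms will be the rescalings by \<open>q^c\<close> and \<open>q^(-c)\<close>
  for both signs. With this choice \<open>g\<close> changes sides when \<open>s\<close> is
  \<open>Neg\<close>, which the inverse records.\<close>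

definition g_sign :: "sgn \<Rightarrow> nat \<Rightarrow> cq fps" where
  "g_sign s n = (case s of Pos \<Rightarrow> g_series n | Neg \<Rightarrow> inverse (g_series n))"

lemma g_sign_nth_0: "fps_nth (g_sign s n) 0 \<noteq> 0"
  by (cases s) (simp_all add: g_sign_def g_series_nth_0)

text \<open>For \<open>Neg\<close>, substitute \<open>x xi^(-1)\<close> for \<open>x\<close> in the
  identity for \<open>g(x) g(x xi)\<close> and invert.\<close>

lemma g_sign_dilate:
  "\<exists>c. c \<noteq> 0 \<and> qdilate (shift_exp s n 0) (g_sign s n) * g_sign s n =
    linfrac c (sg s * (- 2 * int n)) (sg s * (- 2 * int n - 2)) * linfrac 1 0 (- 2 * sg s)"
proof -
  obtain c where c: "c \<noteq> 0" "g_series n * qdilate (- 2 * int n - 2) (g_series n) =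
    linfrac c (- 2 * int n) (- 2 * int n - 2) * linfrac 1 0 (-2)"
    using g_series_dilate by blast
  show ?thesis
  proof (cases s)
    case Pos
    thus ?thesis using c by (intro exI[of _ c]) (simp add: g_sign_def shift_exp_def mult.commute)
  next
    case Neg
    have "qdilate (2 * int n + 2) (g_series n) * g_series n =
        qdilate (2 * int n + 2) (g_series n * qdilate (- 2 * int n - 2) (g_series n))"
      unfolding qdilate_mult qdilate_qdilate by simp
    also have "\<dots> = linfrac c 2 0 * linfrac 1 (2 * int n + 2) (2 * int n)"
      unfolding c(2) qdilate_mult qdilate_linfrac by simp
    finally have "inverse (qdilate (2 * int n + 2) (g_series n) * g_series n) =
        inverse (linfrac c 2 0 * linfrac 1 (2 * int n + 2) (2 * int n))"
      by (rule arg_cong)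
    also have "\<dots> = fps_const (inverse c) * linfrac 1 (2 * int n) (2 * int n + 2) * linfrac 1 0 2"
      using c(1) by (simp add: fps_inverse_mult linfrac_inverse)
        (simp add: linfrac_def mult_ac)
    also have "fps_const (inverse c) * linfrac 1 (2 * int n) (2 * int n + 2) =
        linfrac (inverse c) (2 * int n) (2 * int n + 2)"
      by (simp add: linfrac_def)
    finally have "qdilate (2 * int n + 2) (inverse (g_series n)) * inverse (g_series n) =
        linfrac (inverse c) (2 * int n) (2 * int n + 2) * linfrac 1 0 2"
      by (simp add: fps_inverse_mult qdilate_inverse g_series_nth_0)
    thus ?thesis
      using Neg c(1) by (intro exI[of _ "inverse c"]) (simp add: g_sign_def shift_exp_def add.commute)
  qed
qed

text \<open>The factors of \<open>h\<^sub>i\<^sup>\<plusminus>(u)\<close> against \<open>h\<^sub>j\<^sup>\<mp>(v)\<close>, up to the common factor \<open>g_sign s n\<close>.\<close>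

definition h_factor :: "sgn \<Rightarrow> nat \<Rightarrow> nat \<Rightarrow> nat \<Rightarrow> cq fps" where
  "h_factor s n j i = (let d = (if min i j = n then 2 else 1) in
     if i = j then 1
     else if i < j then linfrac (q powi (sg s * d)) 0 (2 * sg s * d)
     else linfrac (q powi (sg s * d)) (- 2 * sg s * d) 0)"

lemma h_factor_nth_0: "fps_nth (h_factor s n j i) 0 \<noteq> 0"
  by (simp add: h_factor_def Let_def)

text \<open>Telescoping leaves the dilation by \<open>xi^s\<close> divided by the one by
  \<open>q^(-4s)\<close>. The latter cancels against the factor of \<open>h_n\<close>, and
  \<open>h_(n+1)\<close> supplies the undilated series.\<close>

lemma z_factor_g_sign:
  assumes "1 \<le> n"
  shows "z_factor s n (\<lambda>_. g_sign s n) = qdilate (shift_exp s n 0) (g_sign s n) * g_sign s n"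
proof -
  have "shift_exp s n (int n - 1) = - 4 * sg s"
    by (simp add: shift_exp_def)
  thus ?thesis
    unfolding z_factor_regroup[OF assms] telescope[OF g_sign_nth_0 order.refl assms]
    using g_sign_nth_0[of s n] by (simp add: mult.assoc inverse_mult_eq_1)
qed

text \<open>The product telescopes separately over \<open>i < j\<close> and \<open>i > j\<close>,
  and the seam at \<open>j\<close> closes, so \<open>j\<close> affects at most the constant. Up to a
  constant the result is reciprocal to that of \<open>g_sign_dilate\<close>.\<close>

lemma z_factor_h:
  assumes "1 \<le> j" "j \<le> n + 1" "1 \<le> n"
  shows "\<exists>c. c \<noteq> 0 \<and> z_factor s n (h_factor s n j) =
    linfrac c (sg s * (- 2 * int n - 2)) (sg s * (- 2 * int n)) * linfrac 1 (- 2 * sg s) 0"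
proof -
  let ?r = "h_factor s n j"
  let ?D = "\<lambda>r i. qdilate (shift_exp s n (int i - 1)) r * inverse (qdilate (shift_exp s n (int i)) r)"
  define F where "F = linfrac (q powi sg s) 0 (2 * sg s)"
  define F' where "F' = linfrac (q powi sg s) (- 2 * sg s) 0"
  have unit: "fps_nth F 0 \<noteq> 0" "fps_nth F' 0 \<noteq> 0" by (simp_all add: F_def F'_def)
  have r: "?r i = (if i = j then 1 else if i < j then F else F')" if "min i j \<noteq> n" for i
    using that by (auto simp: h_factor_def F_def F'_def)
  have e: "shift_exp s n (k - 1) = shift_exp s n k - 2 * sg s" for k
    by (simp add: shift_exp_def algebra_simps)
  have e0: "shift_exp s n 0 = sg s * (- 2 * int n - 2)"
    "shift_exp s n 0 + 2 * sg s = sg s * (- 2 * int n)"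
    by (simp_all add: shift_exp_def algebra_simps)
  have en: "shift_exp s n (int n) = - 2 * sg s"
    by (simp add: shift_exp_def algebra_simps)
  have F0: "qdilate (shift_exp s n 0) F =
      linfrac (q powi sg s) (sg s * (- 2 * int n - 2)) (sg s * (- 2 * int n))"
    unfolding e0[symmetric] by (simp add: F_def qdilate_linfrac add.commute)
  consider "j < n" | "j = n" | "j = n + 1" using assms by linarith
  thus ?thesis
  proof cases
    case 1
    have "{1..<n} = {1..<j} \<union> {j} \<union> {j + 1..<n}"
      using 1 assms by auto
    hence "(\<Prod>i=1..<n. ?D (?r i) i) =
        (\<Prod>i=1..<j. ?D (?r i) i) * ?D (?r j) j * (\<Prod>i=j + 1..<n. ?D (?r i) i)"
      by (simp add: prod.union_disjoint)
    also have "(\<Prod>i=1..<j. ?D (?r i) i) = (\<Prod>i=1..<j. ?D F i)"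
      using 1 by (intro prod.cong refl) (auto simp: r)
    also have "\<dots> = qdilate (shift_exp s n 0) F * inverse (qdilate (shift_exp s n (int j - 1)) F)"
      using telescope[OF unit(1) order.refl assms(1)] by simp
    also have "?D (?r j) j = 1"
      using 1 by (simp add: r)
    also have "(\<Prod>i=j + 1..<n. ?D (?r i) i) = (\<Prod>i=j + 1..<n. ?D F' i)"
      using 1 by (intro prod.cong refl) (auto simp: r)
    also have "\<dots> = qdilate (shift_exp s n (int j)) F' * inverse (qdilate (- 4 * sg s) F')"
      using telescope[OF unit(2), of "j + 1" n s n] 1 en by (simp add: e)
    finally have "z_factor s n ?r = qdilate (shift_exp s n 0) F *
        (inverse (qdilate (shift_exp s n (int j - 1)) F) * qdilate (shift_exp s n (int j)) F') *
        (inverse (qdilate (- 4 * sg s) F') * qdilate (- 4 * sg s) F') * F'"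
      using 1 assms by (simp add: z_factor_regroup r mult_ac)
    also have "inverse (qdilate (- 4 * sg s) F') * qdilate (- 4 * sg s) F' = 1"
      using unit(2) by (simp add: inverse_mult_eq_1)
    \<comment> \<open>\<open>F'\<close> is \<open>F\<close> dilated by \<open>q^(-2s)\<close>, which
      is exactly the step from index \<open>j\<close> to \<open>j - 1\<close>.\<close>
    also have "inverse (qdilate (shift_exp s n (int j - 1)) F) * qdilate (shift_exp s n (int j)) F' = 1"
    proof -
      have "qdilate (shift_exp s n (int j - 1)) F = qdilate (shift_exp s n (int j)) F'"
        by (simp add: F_def F'_def qdilate_linfrac e add.commute)
      thus ?thesis using unit(2) by (simp add: inverse_mult_eq_1)
    qed
    finally show ?thesis
      unfolding F0 mult_1_right
      by (intro exI[of _ "(q powi sg s)^2"]) (simp add: F'_def linfrac_def power2_eq_square mult_ac flip: fps_const_mult)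
  next
    case 2
    have "?r i = F" if "i \<in> {1..<n}" for i
      using r[of i] that 2 by auto
    hence "(\<Prod>i=1..<n. ?D (?r i) i) = (\<Prod>i=1..<n. ?D F i)"
      by (intro prod.cong refl) simp
    also have "\<dots> = qdilate (shift_exp s n 0) F * inverse (qdilate (- 4 * sg s) F)"
      using telescope[OF unit(1) order.refl assms(3), of s n] en by (simp add: e)
    \<comment> \<open>The exceptional pair \<open>(n, n + 1)\<close>, with \<open>d = 2\<close>,
      enters through the factor of \<open>h_(n+1)\<close>.\<close>
    finally have "z_factor s n ?r = qdilate (shift_exp s n 0) F *
        (inverse (qdilate (- 4 * sg s) F) * linfrac (q powi (sg s * 2)) (- 4 * sg s) 0)"
      using 2 assms by (simp add: z_factor_regroup h_factor_def mult_ac)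
    also have "inverse (qdilate (- 4 * sg s) F) * linfrac (q powi (sg s * 2)) (- 4 * sg s) 0 =
        linfrac (inverse (q powi sg s) * q powi (sg s * 2)) (- 2 * sg s) 0"
      by (simp add: F_def qdilate_linfrac linfrac_inverse linfrac_chain)
    finally show ?thesis
      unfolding F0
      by (intro exI[of _ "q powi sg s * (inverse (q powi sg s) * q powi (sg s * 2))"])
        (simp add: linfrac_def mult_ac flip: fps_const_mult)
  next
    case 3
    have "?r i = F" if "i \<in> {1..<n}" for i
      using r[of i] that 3 by auto
    hence "(\<Prod>i=1..<n. ?D (?r i) i) = (\<Prod>i=1..<n. ?D F i)"
      by (intro prod.cong refl) simp
    also have "\<dots> = qdilate (shift_exp s n 0) F * inverse (qdilate (- 4 * sg s) F)"
      using telescope[OF unit(1) order.refl assms(3), of s n] en by (simp add: e)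
    finally have "(\<Prod>i=1..<n. ?D (?r i) i) =
        qdilate (shift_exp s n 0) F * inverse (qdilate (- 4 * sg s) F)" .
    \<comment> \<open>The exceptional pair now enters through \<open>h_n\<close>; dilation by
      \<open>q^(-4s)\<close> turns its factor into the one that \<open>h_(n+1)\<close> has for
      \<open>j = n\<close>.\<close>
    moreover have "?r n = linfrac (q powi (sg s * 2)) 0 (4 * sg s)" "?r (n + 1) = 1"
      using 3 by (simp_all add: h_factor_def)
    ultimately have "z_factor s n ?r = qdilate (shift_exp s n 0) F *
        (inverse (qdilate (- 4 * sg s) F) * linfrac (q powi (sg s * 2)) (- 4 * sg s) 0)"
      using assms by (simp add: z_factor_regroup qdilate_linfrac mult.assoc)
    also have "inverse (qdilate (- 4 * sg s) F) * linfrac (q powi (sg s * 2)) (- 4 * sg s) 0 =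
        linfrac (inverse (q powi sg s) * q powi (sg s * 2)) (- 2 * sg s) 0"
      by (simp add: F_def qdilate_linfrac linfrac_inverse linfrac_chain)
    finally show ?thesis
      unfolding F0
      by (intro exI[of _ "q powi sg s * (inverse (q powi sg s) * q powi (sg s * 2))"])
        (simp add: linfrac_def mult_ac flip: fps_const_mult)
  qed
qed

text \<open>The rational parts of the two products are reciprocal. A constant is enough, because
  rescaling the argument fixes constants.\<close>

lemma z_factor_g_h:
  assumes "1 \<le> j" "j \<le> n + 1" "1 \<le> n"
  shows "\<exists>c. c \<noteq> 0 \<and> z_factor s n (\<lambda>i. g_sign s n * h_factor s n j i) = fps_const c"
proof -
  let ?a = "sg s * (- 2 * int n)" and ?b = "sg s * (- 2 * int n - 2)"
  obtain c where c: "c \<noteq> 0" "qdilate (shift_exp s n 0) (g_sign s n) * g_sign s n =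
      linfrac c ?a ?b * linfrac 1 0 (- 2 * sg s)"
    using g_sign_dilate by blast
  obtain d where d: "d \<noteq> 0" "z_factor s n (h_factor s n j) =
      linfrac d ?b ?a * linfrac 1 (- 2 * sg s) 0"
    using z_factor_h[OF assms] by blast
  have "z_factor s n (\<lambda>i. g_sign s n * h_factor s n j i) =
      (linfrac c ?a ?b * linfrac d ?b ?a) * (linfrac 1 0 (- 2 * sg s) * linfrac 1 (- 2 * sg s) 0)"
    unfolding z_factor_mult z_factor_g_sign[OF assms(3)] c d by (simp only: mult_ac)
  also have "\<dots> = fps_const (c * d)"
    by (simp only: linfrac_chain linfrac_same) simp
  finally show ?thesis using c d by (intro exI[of _ "c * d"]) simp
qed


section \<open>Algebras satisfying the relations\<close>

text \<open>A relation is read in the source, \<open>collapse\<close> identifies the images of its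
  two sides, and naturality rewrites these images in the target. \<open>centralI\<close> stands for
  generation of the target by the generators and the scalars.\<close>

locale presented = generators_hom n scal gen scal' gen' \<phi>
  for n :: nat and scal :: "cq \<Rightarrow> 'a::ring_1" and gen :: "symbol \<Rightarrow> 'a"
    and scal' :: "cq \<Rightarrow> 'b::ring_1" and gen' :: "symbol \<Rightarrow> 'b" and \<phi> +
  assumes n_pos: "1 \<le> n"
    and collapse: "A.rel x y \<Longrightarrow> \<phi> x = \<phi> y"
    and scal'_add: "scal' (a + b) = scal' a + scal' b"
    and scal'_mult: "scal' (a * b) = scal' a * scal' b"
    and scal'_one: "scal' 1 = 1"
    and scal'_central: "central (scal' a)"
    and centralI: "(\<And>w. in_range n w \<Longrightarrow> t * gen' w = gen' w * t) \<Longrightarrow> central t"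
begin

lemma relation: "A.rel x y \<Longrightarrow> \<phi> x = x' \<Longrightarrow> \<phi> y = y' \<Longrightarrow> x' = y'"
  using collapse by blast

section \<open>Rescaling by powers of \<open>q^(c/2)\<close>\<close>

lemma qc_central: "central (B.qc e)"
proof -
  have pos: "central (gen' (CS Pos))"
  proof (rule centralI)
    fix w assume w: "in_range n w"
    have "B.qc 1 * gen' w = gen' w * B.qc 1"
      by (rule relation[OF A.c_central[OF w]]; intro transport)
    thus "gen' (CS Pos) * gen' w = gen' w * gen' (CS Pos)"
      by (simp add: B.qc_def)
  qed
  have inv: "gen' (CS Pos) * gen' (CS Neg) = 1" "gen' (CS Neg) * gen' (CS Pos) = 1"
  proof -
    have "B.qc 1 * B.qc (-1) = 1"
      by (rule relation[OF A.c_inv_right]; intro transport)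
    thus "gen' (CS Pos) * gen' (CS Neg) = 1" by (simp add: B.qc_def)
    have "B.qc (-1) * B.qc 1 = 1"
      by (rule relation[OF A.c_inv_left]; intro transport)
    thus "gen' (CS Neg) * gen' (CS Pos) = 1" by (simp add: B.qc_def)
  qed
  \<comment> \<open>The relations state centrality for \<open>q^(c/2)\<close> only; multiplying by
    the inverse on both sides carries it over.\<close>
  have "central (gen' (CS Neg))"
    unfolding central_def
  proof
    fix y
    have "gen' (CS Neg) * y = gen' (CS Neg) * (y * gen' (CS Pos)) * gen' (CS Neg)"
      by (simp add: mult.assoc inv)
    also have "y * gen' (CS Pos) = gen' (CS Pos) * y"
      using pos by (simp add: central_def)
    also have "gen' (CS Neg) * (gen' (CS Pos) * y) * gen' (CS Neg) = y * gen' (CS Neg)"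
      by (simp add: inv flip: mult.assoc)
    finally show "gen' (CS Neg) * y = y * gen' (CS Neg)" .
  qed
  with pos show ?thesis by (simp add: B.qc_def central_power)
qed

lemma qc_mult_nat: "B.qc (e * int k) = B.qc e ^ k"
  by (cases "k = 0"; cases "0 \<le> e")
    (auto simp: B.qc_def zero_le_mult_iff nat_mult_distrib power_mult minus_mult_left
      simp del: mult_minus_left)

lemma rescale_nth: "fps_nth (B.rescale e r) k = B.qc e ^ k * scal' (fps_nth r k)"
  by (simp add: B.rescale_def qc_mult_nat)

lemma scal'_zero: "scal' 0 = 0"
  using scal'_add[of 0 0] by simp

lemma scal'_sum: "scal' (sum f S) = (\<Sum>x\<in>S. scal' (f x))"
  by (induction S rule: infinite_finite_induct) (auto simp: scal'_zero scal'_add)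

lemma rescale_one: "B.rescale e 1 = 1"
  by (simp add: fps_eq_iff rescale_nth scal'_one scal'_zero)

lemma rescale_const: "B.rescale e (fps_const c) = fps_const (scal' c)"
  by (simp add: fps_eq_iff rescale_nth scal'_zero)

lemma rescale_mult: "B.rescale e (r * t) = B.rescale e r * B.rescale e t"
proof (rule fps_ext)
  fix m
  have "B.qc e ^ m * (scal' x * scal' y) = B.qc e ^ i * scal' x * (B.qc e ^ (m - i) * scal' y)"
    if "i \<in> {0..m}" for i x y
  proof -
    have "B.qc e ^ m * (scal' x * scal' y) = B.qc e ^ i * (B.qc e ^ (m - i) * scal' x) * scal' y"
      using that by (simp flip: mult.assoc power_add)
    also have "B.qc e ^ (m - i) * scal' x = scal' x * B.qc e ^ (m - i)"
      using scal'_central[of x] by (simp add: central_def)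
    finally show ?thesis by (simp only: mult.assoc)
  qed
  thus "fps_nth (B.rescale e (r * t)) m = fps_nth (B.rescale e r * B.rescale e t) m"
    by (simp add: fps_mult_nth rescale_nth scal'_sum scal'_mult sum_distrib_left)
qed

lemma rescale_central: "central_fps (B.rescale e r)"
  by (auto simp: central_fps_def rescale_nth intro!: central_mult central_power qc_central scal'_central)

lemma rescale_dilate:
  "fps_nth (B.rescale e (dilate c r)) k = scal' (c ^ k) * fps_nth (B.rescale e r) k"
proof -
  have "B.qc e ^ k * scal' (c ^ k) = scal' (c ^ k) * B.qc e ^ k"
    using scal'_central[of "c ^ k"] by (simp add: central_def)
  thus ?thesis
    by (simp only: rescale_nth fps_compose_linear fps_nth_Abs_fps scal'_mult mult.assoc[symmetric])
qed

text \<open>The map sending every series to 1 qualifies, since only multiplicativity is asked for,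
  not additivity. It serves relations in which just one rescaling occurs.\<close>

lemma scalar_homsI:
  assumes "\<Phi> \<in> insert (\<lambda>_. 1) (range B.rescale)" "\<Psi> \<in> insert (\<lambda>_. 1) (range B.rescale)"
  shows "scalar_homs scal' \<Phi> \<Psi>"
proof -
  have "F 1 = 1 \<and> F (r * t) = F r * F t \<and> central_fps (F r) \<and>
      fps_nth (F (dilate c r)) k = scal' (c ^ k) * fps_nth (F r) k"
    if "F \<in> insert (\<lambda>_. 1) (range B.rescale)" for F r t c k
    using that rescale_dilate[of _ r c k]
    by (auto simp: rescale_one rescale_mult rescale_central central_fps_one scal'_one)
  with assms show ?thesis
    by unfold_locales (auto simp: scal'_mult scal'_central)
qed

lemma h_hinv:
  assumes "1 \<le> i" "i \<le> n + 1"
  shows "B.h s i * B.hinv s i = 1" "B.hinv s i * B.h s i = 1"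
proof -
  have "fps_nth (B.h s i) 0 * fps_nth (B.h (opp s) i) 0 = 1" for s
    by (rule relation[OF A.h_inv[OF assms, where s = s]]; intro transport)
  thus "B.h s i * B.hinv s i = 1" "B.hinv s i * B.h s i = 1"
    by (rule B.hinv_inverse)+
qed

text \<open>\<open>swaps\<close> respects products, inverses and shifts of the argument, from which
  \<open>z\<close> is built.\<close>

lemma swaps_z:
  assumes "scalar_homs scal' \<Phi> \<Psi>"
    and h: "\<And>i. 1 \<le> i \<Longrightarrow> i \<le> n + 1 \<Longrightarrow> scalar_homs.swaps \<Phi> \<Psi> s (B.h s i) Y (r i)"
    and r: "\<And>i. 1 \<le> i \<Longrightarrow> i \<le> n + 1 \<Longrightarrow> fps_nth (r i) 0 \<noteq> 0"
  shows "scalar_homs.swaps \<Phi> \<Psi> s (B.z s) Y (z_factor s n r)"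
proof -
  interpret scalar_homs scal' \<Phi> \<Psi> by fact
  have exp: "(xi n * q powi (2 * int i)) powi sg s = q powi (shift_exp s n (int i))"
    "(xi n * q powi (2 * int i - 2)) powi sg s = q powi (shift_exp s n (int i - 1))" for i
  proof -
    have "xi n * q powi (2 * int i) = q powi (2 * int i - 2 * int n - 2)"
      "xi n * q powi (2 * int i - 2) = q powi (2 * (int i - 1) - 2 * int n - 2)"
      by (simp_all add: xi_def algebra_simps flip: power_int_add)
    thus "(xi n * q powi (2 * int i)) powi sg s = q powi (shift_exp s n (int i))"
      "(xi n * q powi (2 * int i - 2)) powi sg s = q powi (shift_exp s n (int i - 1))"
      by (simp_all only: shift_exp_def power_int_mult[symmetric] mult.commute[of "sg s"])
  qed
  have prod: "prod_list (map f [1..<m]) = (\<Prod>i=1..<m. f i)" for f :: "nat \<Rightarrow> cq fps" and m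
    using prod.distinct_set_conv_list[of "[1..<m]" f] by simp
  have "swaps s
      (prod_list (map (\<lambda>i. B.fps_shift_arg s (xi n * q powi (2 * int i)) (B.hinv s i)) [1..<n]))
      Y (prod_list (map (\<lambda>i. inverse (qdilate (shift_exp s n (int i)) (r i))) [1..<n]))"
  proof (rule swaps_prod_list)
    fix i assume i: "i \<in> set [1..<n]"
    hence "swaps s (B.hinv s i) Y (inverse (r i))"
      by (intro swaps_inverse[OF h] h_hinv r) auto
    from swaps_fps_shift_arg[OF this, of "xi n * q powi (2 * int i)"] i r[of i]
    show "swaps s (B.fps_shift_arg s (xi n * q powi (2 * int i)) (B.hinv s i)) Y
        (inverse (qdilate (shift_exp s n (int i)) (r i)))"
      unfolding exp by (simp add: qdilate_inverse)
  qed
  moreover have "swaps s (prod_list (map (\<lambda>i. B.fps_shift_arg s (xi n * q powi (2 * int i - 2)) (B.h s i)) [1..<n + 1]))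
      Y (prod_list (map (\<lambda>i. qdilate (shift_exp s n (int i - 1)) (r i)) [1..<n + 1]))"
  proof (rule swaps_prod_list)
    fix i assume i: "i \<in> set [1..<n + 1]"
    hence "swaps s (B.h s i) Y (r i)"
      by (intro h) auto
    from swaps_fps_shift_arg[OF this, of "xi n * q powi (2 * int i - 2)"]
    show "swaps s (B.fps_shift_arg s (xi n * q powi (2 * int i - 2)) (B.h s i)) Y
        (qdilate (shift_exp s n (int i - 1)) (r i))"
      unfolding exp .
  qed
  ultimately show ?thesis
    unfolding B.z_def z_factor_def prod[symmetric] by (intro swaps_mult h) auto
qed

section \<open>Exchange with the series \<open>X_j\<close>\<close>

lemma exchange_h_Xplus:
  assumes "1 \<le> i" "i \<le> n" "1 \<le> j" "j \<le> n"
  shows "exchange s (B.h s i) (B.Xser Pos j) 1 (B.rescale (-1) (X_factor s n j i))"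
proof -
  let ?e = "ip n (eps i) (alpha n j)"
  have "exchange s (B.h s i) (B.Xser Pos j) 1
      (B.rfac s 0 (sg s) 1 1 (q powi ?e) (q powi (- ?e)))"
  proof (rule exchangeI')
    fix a b
    show "prod_uv (B.hser s i) (B.Xser Pos j) a b =
      ratio_mult s (B.rfac s 0 (sg s) 1 1 (q powi ?e) (q powi (- ?e)))
        (prod_vu (B.Xser Pos j) (B.hser s i)) a b"
      by (rule relation[OF A.h_Xplus[OF assms refl, where s = s and a = a and b = b]];
          intro transport)
  qed
  \<comment> \<open>Inside a series in \<open>(u/v)^s\<close> the shift of \<open>v\<close> by
    \<open>q^(sc/2)\<close> amounts to rescaling by \<open>q^(-c/2)\<close> for both signs.\<close>
  thus ?thesis
    using assms by (simp add: B.rfac_def expand_sym X_factor_def)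
qed

lemma exchange_h_Xminus:
  assumes "1 \<le> i" "i \<le> n" "1 \<le> j" "j \<le> n"
  shows "exchange s (B.h s i) (B.Xser Neg j) 1 (B.rescale 1 (inverse (X_factor s n j i)))"
proof -
  let ?e = "ip n (eps i) (alpha n j)"
  have "exchange s (B.h s i) (B.Xser Neg j) 1
      (B.rfac s (sg s) 0 (q powi ?e) (q powi (- ?e)) 1 1)"
  proof (rule exchangeI')
    fix a b
    show "prod_uv (B.hser s i) (B.Xser Neg j) a b =
      ratio_mult s (B.rfac s (sg s) 0 (q powi ?e) (q powi (- ?e)) 1 1)
        (prod_vu (B.Xser Neg j) (B.hser s i)) a b"
      by (rule relation[OF A.h_Xminus[OF assms refl, where s = s and a = a and b = b]];
          intro transport)
  qed
  thus ?thesis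
    using assms by (simp add: B.rfac_def expand_sym_inverse X_factor_def)
qed

lemma exchange_hlast_Xplus_n:
  "exchange s (B.h s (n + 1)) (B.Xser Pos n) 1 (B.rescale (-1) (X_factor s n n (n + 1)))"
proof -
  have "exchange s (B.h s (n + 1)) (B.Xser Pos n) 1
      (B.rfac s (- sg s) 0 1 1 (q powi -2) (q powi 2))"
  proof (rule exchangeI')
    fix a b
    show "prod_uv (B.hser s (n + 1)) (B.Xser Pos n) a b =
      ratio_mult s (B.rfac s (- sg s) 0 1 1 (q powi -2) (q powi 2))
        (prod_vu (B.Xser Pos n) (B.hser s (n + 1))) a b"
      by (rule relation[OF A.hlast_Xplus_n[where s = s and a = a and b = b]]; intro transport)
  qed
  thus ?thesis
    using expand_sym[of s "-2"] by (simp add: B.rfac_def X_factor_def)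
qed

lemma exchange_hlast_Xminus_n:
  "exchange s (B.h s (n + 1)) (B.Xser Neg n) 1 (B.rescale 1 (inverse (X_factor s n n (n + 1))))"
proof -
  have "exchange s (B.h s (n + 1)) (B.Xser Neg n) 1
      (B.rfac s (sg s) 0 (q powi -2) (q powi 2) 1 1)"
  proof (rule exchangeI')
    fix a b
    show "prod_uv (B.hser s (n + 1)) (B.Xser Neg n) a b =
      ratio_mult s (B.rfac s (sg s) 0 (q powi -2) (q powi 2) 1 1)
        (prod_vu (B.Xser Neg n) (B.hser s (n + 1))) a b"
      by (rule relation[OF A.hlast_Xminus_n[where s = s and a = a and b = b]]; intro transport)
  qed
  thus ?thesis
    using expand_sym_inverse[of s "-2"] by (simp add: B.rfac_def X_factor_def)
qed

text \<open>\<open>only_v\<close> leaves the single summand \<open>k = m\<close>, so a conjugation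
  relation becomes an equation between power series in \<open>u^s\<close>.\<close>

lemma prod_uvu_eq_twist:
  assumes "\<And>a b. prod_uvu s F X G a b = ratio_mult s r (only_v X) a b"
  shows "F * fps_const (X b) * G = twist s r X (b :: int)"
proof (rule fps_ext)
  fix m
  have "ratio_mult s r (only_v X) (sg s * int m) b =
      (\<Sum>k\<le>m. if k = m then fps_nth r m * X (b + sg s * int m) else 0)"
    unfolding ratio_mult_def sg_square nat_int
    by (intro sum.cong refl) (cases s; auto simp: only_v_def)
  also have "\<dots> = fps_nth (twist s r X b) m"
    by (simp add: twist_def)
  also have "ratio_mult s r (only_v X) (sg s * int m) b = fps_nth (F * fps_const (X b) * G) m"
    unfolding assms[symmetric] prod_uvu_def fps_mult_nth[of _ G] by (simp add: atLeast0AtMost)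
  finally show "fps_nth (F * fps_const (X b) * G) m = fps_nth (twist s r X b) m" .
qed

lemma twist_one: "twist s 1 X b = fps_const (X b)"
  by (simp add: twist_def fps_eq_iff)

lemma exchange_hlast_Xplus_pred:
  assumes "2 \<le> n"
  shows "exchange s (B.h s (n + 1)) (B.Xser Pos (n - 1))
    (B.rescale (-1) (inverse (X_factor s n (n - 1) (n + 1)))) 1"
proof -
  let ?r = "B.rescale (-1) (inverse (X_factor s n (n - 1) (n + 1)))"
  have r: "B.rfac s 0 (sg s) (inverse q) q (q powi -2) (q powi 2) = ?r"
  proof -
    have "n - 1 \<noteq> n" "n - 1 + 1 = n"
      using assms by auto
    thus ?thesis
      using expand_pred[of s]
      by (simp add: B.rfac_def X_factor_def linfrac_inverse power_int_minus)
  qed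
  have "prod_uvu s (B.hinv s (n + 1)) (B.Xser Pos (n - 1)) (B.h s (n + 1)) a b =
      ratio_mult s (B.rfac s 0 (sg s) (inverse q) q (q powi -2) (q powi 2))
        (only_v (B.Xser Pos (n - 1))) a b" for a b
    by (rule relation[OF A.hlast_Xplus_pred[OF assms, where s = s and a = a and b = b]];
        intro transport)
  hence eq: "B.hinv s (n + 1) * fps_const (B.Xser Pos (n - 1) b) * B.h s (n + 1) =
      twist s ?r (B.Xser Pos (n - 1)) b" for b
    unfolding r by (rule prod_uvu_eq_twist)
  \<comment> \<open>Multiplying the conjugation by \<open>h_(n+1)\<close> on the left puts the
    factor on the left of the exchange, unlike in the other relations for
    \<open>X^+\<close>.\<close>
  show ?thesis
    unfolding exchange_iff_twist[OF rescale_central] twist_one eq[symmetric]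
    using h_hinv[of "n + 1" s] by (simp flip: mult.assoc)
qed

lemma exchange_hlast_Xminus_pred:
  assumes "2 \<le> n"
  shows "exchange s (B.h s (n + 1)) (B.Xser Neg (n - 1)) 1
    (B.rescale 1 (inverse (X_factor s n (n - 1) (n + 1))))"
proof -
  let ?r = "B.rescale 1 (inverse (X_factor s n (n - 1) (n + 1)))"
  have r: "B.rfac s 0 (- sg s) (inverse q) q (q powi -2) (q powi 2) = ?r"
  proof -
    have "n - 1 \<noteq> n" "n - 1 + 1 = n"
      using assms by auto
    thus ?thesis
      using expand_pred[of s]
      by (simp add: B.rfac_def X_factor_def linfrac_inverse power_int_minus)
  qed
  have "prod_uvu s (B.h s (n + 1)) (B.Xser Neg (n - 1)) (B.hinv s (n + 1)) a b =
      ratio_mult s (B.rfac s 0 (- sg s) (inverse q) q (q powi -2) (q powi 2))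
        (only_v (B.Xser Neg (n - 1))) a b" for a b
    by (rule relation[OF A.hlast_Xminus_pred[OF assms, where s = s and a = a and b = b]];
        intro transport)
  hence eq: "B.h s (n + 1) * fps_const (B.Xser Neg (n - 1) b) * B.hinv s (n + 1) =
      twist s ?r (B.Xser Neg (n - 1)) b" for b
    unfolding r by (rule prod_uvu_eq_twist)
  show ?thesis
    unfolding exchange_iff_twist[OF central_fps_one] twist_one eq[symmetric]
    using h_hinv[of "n + 1" s] by (simp add: mult.assoc)
qed

lemma exchange_hlast_X:
  assumes "1 \<le> j" "j + 2 \<le> n"
  shows "exchange s (B.h s (n + 1)) (B.Xser t j) 1 1"
proof (rule exchangeI')
  fix a b
  have "prod_uv (B.hser s (n + 1)) (B.Xser t j) a b = prod_vu (B.Xser t j) (B.hser s (n + 1)) a b"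
    by (rule relation[OF A.hlast_X[OF assms, where s = s and t = t and a = a and b = b]];
        intro transport)
  thus "prod_uv (B.hser s (n + 1)) (B.Xser t j) a b =
      ratio_mult s 1 (prod_vu (B.Xser t j) (B.hser s (n + 1))) a b"
    by (simp add: ratio_mult_one)
qed

lemma X_factor_nth_0: "fps_nth (X_factor s n j i) 0 \<noteq> 0"
  by (simp add: X_factor_def)

lemma z_Xplus:
  assumes j: "1 \<le> j" "j \<le> n"
  shows "fps_nth (B.z s) m * B.Xser Pos j b = B.Xser Pos j b * fps_nth (B.z s) m"
proof -
  \<comment> \<open>All factors against \<open>X^+\<close> are rescaled by \<open>q^(-c/2)\<close>,
    so the other homomorphism can be trivial.\<close>
  have homs: "scalar_homs scal' (\<lambda>_. 1) (B.rescale (-1))"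
    by (rule scalar_homsI) auto
  interpret scalar_homs scal' "\<lambda>_. 1" "B.rescale (-1)" by (fact homs)
  have "swaps s (B.h s i) (B.Xser Pos j) (X_factor s n j i)" if i: "1 \<le> i" "i \<le> n + 1" for i
  proof -
    consider "i \<le> n" | "i = n + 1" "j = n" | "i = n + 1" "j + 1 = n" | "i = n + 1" "j + 2 \<le> n"
      using i j by linarith
    thus ?thesis
    proof cases
      \<comment> \<open>The inverse factor stands on the left here; \<open>swapsI\<close> with
        numerator 1 brings it to the common form.\<close>
      case 3
      hence "2 \<le> n" "j = n - 1" using j by auto
      thus ?thesis
        using swapsI[where s = s and A = "B.h s i" and Y = "B.Xser Pos j" and a = 1
            and b = "inverse (X_factor s n j i)"]
          exchange_hlast_Xplus_pred[of s] 3(1) X_factor_nth_0[of s j i]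
        by (simp add: rescale_one)
    next
      case 4
      thus ?thesis
        using exchange_hlast_X[OF j(1)] by (simp add: swaps_def X_factor_def rescale_one)
    qed (use i j exchange_h_Xplus exchange_hlast_Xplus_n in \<open>auto simp: swaps_def\<close>)
  qed
  from swaps_z[OF homs this X_factor_nth_0] have "swaps s (B.z s) (B.Xser Pos j) 1"
    unfolding z_factor_X[OF j] .
  thus ?thesis
    by (rule swaps_cancel) (simp_all add: rescale_one)
qed

lemma z_Xminus:
  assumes j: "1 \<le> j" "j \<le> n"
  shows "fps_nth (B.z s) m * B.Xser Neg j b = B.Xser Neg j b * fps_nth (B.z s) m"
proof -
  have homs: "scalar_homs scal' (B.rescale 1) (\<lambda>_. 1)"
    by (rule scalar_homsI) auto
  interpret scalar_homs scal' "B.rescale 1" "\<lambda>_. 1" by (fact homs)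
  \<comment> \<open>Against \<open>X^-\<close> the inverse factor stands on the right; clearing it
    leaves \<open>X_factor\<close> on the left, rescaled by \<open>q^(c/2)\<close>.\<close>
  have inverse: "swaps s A Y (X_factor s n j i)"
    if "exchange s A Y 1 (B.rescale 1 (inverse (X_factor s n j i)))" for A Y i
    using swapsI[where s = s and A = A and Y = Y and a = 1 and b = "inverse (X_factor s n j i)"] that X_factor_nth_0[of s j i]
    by (simp add: rescale_one)
  have "swaps s (B.h s i) (B.Xser Neg j) (X_factor s n j i)" if i: "1 \<le> i" "i \<le> n + 1" for i
  proof -
    consider "i \<le> n" | "i = n + 1" "j = n" | "i = n + 1" "j + 1 = n" | "i = n + 1" "j + 2 \<le> n"
      using i j by linarith
    thus ?thesis
    proof cases
      case 3
      hence "2 \<le> n" "j = n - 1" using j by auto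
      thus ?thesis
        using exchange_hlast_Xminus_pred[of s] 3(1) by (intro inverse) simp
    next
      case 4
      thus ?thesis
        using exchange_hlast_X[OF j(1)] by (simp add: swaps_def X_factor_def rescale_one)
    next
      case 1
      thus ?thesis using i j by (intro inverse exchange_h_Xminus)
    next
      case 2
      thus ?thesis using exchange_hlast_Xminus_n[of s] by (intro inverse) simp
    qed
  qed
  from swaps_z[OF homs this X_factor_nth_0] have "swaps s (B.z s) (B.Xser Neg j) 1"
    unfolding z_factor_X[OF j] .
  thus ?thesis
    by (rule swaps_cancel) (simp_all add: rescale_one)
qed

section \<open>Exchange among the series \<open>h_i\<close>\<close>

lemma exchange_h_h_same_sign:
  assumes "1 \<le> i" "i \<le> n + 1" "1 \<le> j" "j \<le> n + 1"
  shows "exchange s (B.h s i) (B.hser s j) 1 1"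
proof (rule exchangeI')
  fix a b
  have "prod_uv (B.hser s i) (B.hser s j) a b = prod_vu (B.hser s j) (B.hser s i) a b"
    by (rule relation[OF A.h_h_same_sign[OF assms, where s = s and a = a and b = b]];
        intro transport)
  thus "prod_uv (B.hser s i) (B.hser s j) a b =
      ratio_mult s 1 (prod_vu (B.hser s j) (B.hser s i)) a b"
    by (simp add: ratio_mult_one)
qed

lemma z_h_same_sign:
  assumes "1 \<le> j" "j \<le> n + 1"
  shows "fps_nth (B.z s) m * B.hser s j b = B.hser s j b * fps_nth (B.z s) m"
proof -
  have homs: "scalar_homs scal' (\<lambda>_. 1) (\<lambda>_. 1)"
    by (rule scalar_homsI) auto
  interpret scalar_homs scal' "\<lambda>_. 1" "\<lambda>_. 1" by (fact homs)
  have "swaps s (B.h s i) (B.hser s j) 1" if "1 \<le> i" "i \<le> n + 1" for i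
    unfolding swaps_def using that assms by (rule exchange_h_h_same_sign)
  from swaps_z[OF homs this] show ?thesis
    by (intro swaps_cancel[of s _ _ "z_factor s n (\<lambda>_. 1)"] z_factor_nth_0) auto
qed

lemma exchange_h_h_same_index:
  assumes "1 \<le> i" "i \<le> n + 1"
  shows "exchange s (B.h s i) (B.hser (opp s) i) (B.gfac s 2) (B.gfac s (-2))"
proof (rule exchangeI)
  fix a b
  show "ratio_mult s (B.gfac s 2) (prod_uv (B.hser s i) (B.hser (opp s) i)) a b =
      ratio_mult s (B.gfac s (-2)) (prod_vu (B.hser (opp s) i) (B.hser s i)) a b"
    by (rule relation[OF A.h_h_same_index[OF assms, where s = s and a = a and b = b]];
        intro transport)
qed

text \<open>\<open>d\<close> unites the pair \<open>(n, n + 1)\<close>, which has \<open>q^2\<close>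
  in place of \<open>q\<close>, with the other pairs. The signs of the shifts and of the expansion
  cancel, so the rational factor is rescaled by \<open>q^c\<close> and \<open>q^(-c)\<close> for
  either sign.\<close>

lemma exchange_h_h_less:
  assumes "1 \<le> i" "i < j" "j \<le> n + 1"
  shows "exchange s (B.h s i) (B.hser (opp s) j)
    (B.gfac s 2 * B.rescale 2 (h_factor s n j i)) (B.gfac s (-2) * B.rescale (-2) (h_factor s n j i))"
proof -
  define d :: int where "d = (if i = n then 2 else 1)"
  have "exchange s (B.h s i) (B.hser (opp s) j)
      (B.gfac s 2 * B.rfac s (sg s) (- sg s) 1 1 (q powi d) (q powi (- d)))
      (B.gfac s (-2) * B.rfac s (- sg s) (sg s) 1 1 (q powi d) (q powi (- d)))"
  proof (rule exchangeI)
    fix a b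
    show "ratio_mult s (B.gfac s 2 * B.rfac s (sg s) (- sg s) 1 1 (q powi d) (q powi (- d)))
          (prod_uv (B.hser s i) (B.hser (opp s) j)) a b =
        ratio_mult s (B.gfac s (-2) * B.rfac s (- sg s) (sg s) 1 1 (q powi d) (q powi (- d)))
          (prod_vu (B.hser (opp s) j) (B.hser s i)) a b"
    proof (cases "i = n")
      case True
      hence "j = n + 1" using assms by simp
      have "ratio_mult s (B.gfac s 2 * B.rfac s (sg s) (- sg s) 1 1 (q powi 2) (q powi -2))
            (prod_uv (B.hser s n) (B.hser (opp s) (n + 1))) a b =
          ratio_mult s (B.gfac s (-2) * B.rfac s (- sg s) (sg s) 1 1 (q powi 2) (q powi -2))
            (prod_vu (B.hser (opp s) (n + 1)) (B.hser s n)) a b"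
        by (rule relation[OF A.h_h_last[where s = s and a = a and b = b]]; intro transport)
      thus ?thesis using True \<open>j = n + 1\<close> by (simp add: d_def)
    next
      case False
      have "ratio_mult s (B.gfac s 2 * B.rfac s (sg s) (- sg s) 1 1 q (inverse q))
            (prod_uv (B.hser s i) (B.hser (opp s) j)) a b =
          ratio_mult s (B.gfac s (-2) * B.rfac s (- sg s) (sg s) 1 1 q (inverse q))
            (prod_vu (B.hser (opp s) j) (B.hser s i)) a b"
        by (rule relation[OF A.h_h_less[OF assms False, where s = s and a = a and b = b]];
            intro transport)
      thus ?thesis using False by (simp add: d_def power_int_minus)
    qed
  qed
  moreover have *: "expand s 1 1 (q powi d) (q powi (- d)) = h_factor s n j i"
    using assms unfolding expand_sym by (auto simp: h_factor_def d_def Let_def)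
  moreover have **: "sg s * (sg s - - sg s) = 2" "sg s * (- sg s - sg s) = -2"
    by (cases s; simp)+
  ultimately show ?thesis
    unfolding B.rfac_def * ** by simp
qed

text \<open>The relations for \<open>i \<le> j\<close> apply directly, those for
  \<open>j < i\<close> after interchanging the two series. All are written with the same two
  rescalings, so their factors multiply to a constant, which both rescalings fix.\<close>

lemma z_h_opposite_sign:
  assumes j: "1 \<le> j" "j \<le> n + 1"
  shows "fps_nth (B.z s) m * B.hser (opp s) j b = B.hser (opp s) j b * fps_nth (B.z s) m"
proof -
  have homs: "scalar_homs scal' (B.rescale 2) (B.rescale (-2))"
    by (rule scalar_homsI) auto
  interpret scalar_homs scal' "B.rescale 2" "B.rescale (-2)" by (fact homs)
  let ?g = "g_series n"
  have opp: "opp (opp t) = t" for t by (cases t) auto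
  have "swaps s (B.h s i) (B.hser (opp s) j) (g_sign s n * h_factor s n j i)"
    if i: "1 \<le> i" "i \<le> n + 1" for i
  proof -
    have less: "exchange s (B.h s i) (B.hser (opp s) j)
        (B.gfac s 2 * B.rescale 2 (h_factor s n j i))
        (B.gfac s (-2) * B.rescale (-2) (h_factor s n j i))" if "i \<le> j"
      using that i j exchange_h_h_less[of i j s] exchange_h_h_same_index[of i s]
      by (cases "i = j") (auto simp: h_factor_def rescale_one)
    have greater: "exchange s (B.h s i) (B.hser (opp s) j)
        (B.gfac (opp s) (-2) * B.rescale (-2) (inverse (h_factor s n j i)))
        (B.gfac (opp s) 2 * B.rescale 2 (inverse (h_factor s n j i)))" if "j < i"
    proof -
      \<comment> \<open>Interchanging the series reverses the sign and inverts the factor; this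
        accounts for the last branch of \<open>h_factor\<close>.\<close>
      have "h_factor (opp s) n i j = inverse (h_factor s n j i)"
        using that by (cases s) (auto simp: h_factor_def linfrac_inverse Let_def power_int_minus)
      thus ?thesis
        using exchange_swap[of "opp s" "B.h (opp s) j" "B.h s i"]
          exchange_h_h_less[of j i "opp s"] that i j by (simp add: opp)
    qed
    have unit: "fps_nth ?g 0 \<noteq> 0" "fps_nth (h_factor s n j i) 0 \<noteq> 0"
      by (simp_all add: g_series_nth_0 h_factor_nth_0)
    have comm: "B.rescale e r * B.rescale d t = B.rescale d t * B.rescale e r" for e d r t
      by (rule central_fps_commute[OF rescale_central])
    show ?thesis
    proof (cases "i \<le> j")
      case True
      show ?thesis
      proof (cases s)
        case Pos
        thus ?thesis
          using less[OF True] by (simp add: swaps_def B.gfac_def g_sign_def rescale_mult)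
      next
        \<comment> \<open>\<open>g\<close> occurs with the opposite rescaling and therefore becomes
          the denominator.\<close>
        case Neg
        thus ?thesis
          using less[OF True] swapsI[of s "B.h s i" "B.hser (opp s) j" "h_factor s n j i" ?g] unit
          by (simp add: B.gfac_def g_sign_def comm[of "-2" ?g 2] mult.commute)
      qed
    next
      case False
      show ?thesis
      proof (cases s)
        case Pos
        thus ?thesis
          using greater False unit
            swapsI[of s "B.h s i" "B.hser (opp s) j" ?g "inverse (h_factor s n j i)"]
          by (simp add: B.gfac_def g_sign_def comm[of "-2" ?g 2])
      next
        case Neg
        thus ?thesis
          using greater False unit
            swapsI[of s "B.h s i" "B.hser (opp s) j" 1 "?g * inverse (h_factor s n j i)"]
          by (simp add: B.gfac_def g_sign_def rescale_mult rescale_one fps_inverse_mult)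
      qed
    qed
  qed
  note z = swaps_z[OF homs this]
  obtain c where c: "c \<noteq> 0" "z_factor s n (\<lambda>i. g_sign s n * h_factor s n j i) = fps_const c"
    using z_factor_g_h[OF j n_pos] by blast
  have "swaps s (B.z s) (B.hser (opp s) j) (fps_const c)"
    using z g_sign_nth_0 h_factor_nth_0 by (simp add: c)
  thus ?thesis
    by (rule swaps_cancel) (simp_all add: rescale_const c)
qed

theorem z_central: "central (fps_nth (B.z s) m)"
proof (rule centralI)
  fix w assume w: "in_range n w"
  show "fps_nth (B.z s) m * gen' w = gen' w * fps_nth (B.z s) m"
  proof (cases w)
    case (XS t i k)
    hence "gen' w = B.Xser t i (- k)" by (simp add: B.Xser_def)
    thus ?thesis using w XS z_Xplus z_Xminus by (cases t) auto
  next
    case (HS t i k)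
    hence "gen' w = B.hser t i (sg t * int k)"
      by (simp add: two_sided_def B.h_def)
    moreover have "t = s \<or> t = opp s" by (cases s; cases t) auto
    ultimately show ?thesis using w HS z_h_same_sign z_h_opposite_sign by auto
  next
    case (CS t)
    hence "gen' w = B.qc (sg t)" by (cases t) (auto simp: B.qc_def)
    thus ?thesis using qc_central[of "sg t"] by (simp add: central_def)
  qed
qed

end


section \<open>Passage to the quotient algebra\<close>

lemma free_scal_central: "free_scal c * p = p * (free_scal c :: ('n::finite) free_alg)"
proof -
  have "free_scal c * Poly_Mapping.single w d = Poly_Mapping.single w d * (free_scal c :: 'n free_alg)"
    for w d
    by (simp add: free_scal_def mult_single mult.commute)
  thus ?thesis
    by (subst (1 2) free_alg_expand[of p]) (simp only: sum_distrib_left sum_distrib_right)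
qed

lemma uext_scal_central: "central (uext_scal c :: ('n::finite) uext)"
  unfolding central_def
proof
  fix y :: "'n uext"
  obtain p where "y = abs_uext p"
    by (metis Quotient3_abs_rep Quotient3_uext)
  thus "uext_scal c * y = y * uext_scal c"
    by (simp add: uext_scal_def times_uext.abs_eq free_scal_central)
qed

text \<open>Commuting with generators extends to words by induction, to monomials since scalars are
  central, and to all elements by additivity.\<close>

lemma uext_centralI:
  fixes y :: "('n::finite) uext"
  assumes comm: "\<And>w. in_range CARD('n) w \<Longrightarrow> y * uext_gen w = uext_gen w * y"
  shows "central y"
proof -
  interpret generators_hom "CARD('n)" free_scal free_gen uext_scal uext_gen
    "abs_uext :: _ \<Rightarrow> 'n uext" by (rule uext_generators_hom)
  have word: "y * abs_uext (Poly_Mapping.single (FWord xs) 1) =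
      abs_uext (Poly_Mapping.single (FWord xs) 1) * y" for xs :: "'n generator list"
  proof (induction xs)
    case Nil
    have "Poly_Mapping.single (FWord []) 1 = (1 :: 'n free_alg)"
      by (simp flip: zero_fword_def)
    thus ?case by (simp add: one)
  next
    case (Cons x xs)
    have "Poly_Mapping.single (FWord (x # xs)) 1 =
        free_gen (Rep_generator x) * (Poly_Mapping.single (FWord xs) 1 :: 'n free_alg)"
      by (simp add: free_gen_def mult_single plus_fword_def Rep_generator_inverse)
    hence *: "abs_uext (Poly_Mapping.single (FWord (x # xs)) 1) =
        uext_gen (Rep_generator x) * abs_uext (Poly_Mapping.single (FWord xs) 1)"
      by (simp add: uext_gen_def times_uext.abs_eq)
    have "y * uext_gen (Rep_generator x) = uext_gen (Rep_generator x) * y"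
      using Rep_generator[of x] by (intro comm) simp
    thus ?case unfolding * using Cons.IH by (metis mult.assoc)
  qed
  have single: "y * abs_uext (Poly_Mapping.single w c) = abs_uext (Poly_Mapping.single w c) * y" for w c
  proof -
    have "Poly_Mapping.single w c = free_scal c * (Poly_Mapping.single w 1 :: 'n free_alg)"
      by (simp add: free_scal_def mult_single)
    hence *: "abs_uext (Poly_Mapping.single w c) = uext_scal c * abs_uext (Poly_Mapping.single w 1)"
      by (simp add: uext_scal_def times_uext.abs_eq)
    have "y * uext_scal c = uext_scal c * y"
      using uext_scal_central[of c] unfolding central_def by metis
    thus ?thesis unfolding * using word[of "letters w"] by (metis fword.collapse mult.assoc)
  qed
  show ?thesis
    unfolding central_def
  proof
    fix x :: "'n uext"
    obtain p where p: "x = abs_uext p"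
      by (metis Quotient3_abs_rep Quotient3_uext)
    show "y * x = x * y"
      unfolding p by (subst (1 2) free_alg_expand[of p])
        (simp add: sum sum_distrib_left sum_distrib_right single)
  qed
qed

theorem proposition2p2:
  shows "\<forall>k. central (fps_nth (uext_z Pos :: ('n::finite) uext fps) k) \<and>
             central (fps_nth (uext_z Neg :: 'n uext fps) k)"
proof -
  interpret generators_hom "CARD('n)" free_scal free_gen uext_scal uext_gen
    "abs_uext :: _ \<Rightarrow> 'n uext" by (rule uext_generators_hom)
  \<comment> \<open>The quotient map collapses the relations because the two sides differ by an
    element of the ideal.\<close>
  interpret presented "CARD('n)" free_scal free_gen uext_scal uext_gen "abs_uext :: _ \<Rightarrow> 'n uext"
  proof unfold_locales
    show "1 \<le> CARD('n)" by (simp add: Suc_le_eq)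
    show "abs_uext x = (abs_uext y :: 'n uext)" if "A.rel x y" for x y
      using that by (intro free_rel_uext_eq) (simp add: free_rel_def)
    show "uext_scal (a + b) = (uext_scal a + uext_scal b :: 'n uext)" for a b
      by (simp add: uext_scal_def free_scal_def single_add plus_uext.abs_eq)
    show "uext_scal (a * b) = (uext_scal a * uext_scal b :: 'n uext)" for a b
      by (simp add: uext_scal_def free_scal_def mult_single times_uext.abs_eq)
    show "uext_scal 1 = (1 :: 'n uext)"
      by (simp add: uext_scal_def free_scal_def one)
  qed (use uext_scal_central uext_centralI in auto)
  show ?thesis
    by (simp add: uext_z_def z_central)
qed

end
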